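(* In the two-class mixture model of the context, let $\hat f(x_0)=\hat f_{\hat h(x_0)}(x_0)$ be the adaptive estimator described there. Assume that (A1), (A2), (A3), (A4) are fulfilled and that all $h\in\mathcal H_n$ satisfy (A5). Suppose in addition that the sample size $n$ is larger than a constant that only depends on the kernel $K$. Then, for any $\delta\in(0,1)$, $$\mathbb E\big[(\hat f(x_0)-f(x_0))^2\big]\le C_5^*\min_{h\in\mathcal H_n}\Big\{\|K_h\star f-f\|_{\infty,\mathcal V_n(x_0)}^2+\frac{\log n}{\delta^2\gamma^2nh}\Big\}+\frac{C_6^*}{\delta^6}\sup_{\theta\in[\delta,1-\delta]}\mathbb E\big[|\tilde\theta_n-\theta|^2\big]+\frac{C_7^*}{\delta^2\gamma^2}\mathbb E\big[\|\hat g-g\|_{\infty,\mathcal V_n(x_0)}^2\big]+\frac{C_8^*}{n^2},$$ where $C_5^*,\dots,C_8^*$ are positive constants such that $C_5^*$ depends on $\|g\|_{\infty,\mathcal V_n(x_0)}$, $\|K\|_1$ and $\|K\|_2$; $C_6^*$ depends on $\|K\|_1$; $C_7^*$ depends on $\|g\|_{\infty,\mathcal V_n(x_0)}$ and $\|K\|_1$; and $C_8^*$ depends on $\delta$, $\gamma$, $\|f\|_{\infty,\mathcal V_n(x_0)}$, $g$, $\|K\|_2$ and $\|K\|_\infty$.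
   Context: Model: $f$ is an unknown probability density on $[0,1]$, $\theta\in(0,1)$ is unknown, and $g(x)=\theta+(1-\theta)f(x)$ for $x\in[0,1]$. $X_1,\dots,X_{2n}$ are i.i.d. with density $g$. The preliminary estimators $\hat g$ of $g$ and $\tilde\theta_n$ of $\theta$ are built from $X_{n+1},\dots,X_{2n}$ only, hence are independent of $X_1,\dots,X_n$. The estimation point is $x_0\in[0,1]$. Kernel: $K:\mathbb R\to\mathbb R$ is integrable, bounded, supported in $[-A,A]$ ($A>0$), with $\int K=1$ and $\int K^2<\infty$; $K_h(\cdot)=K(\cdot/h)/h$; $\star$ is convolution; $\|K\|_p$ is the $L^p(\mathbb R)$ norm and $\|K\|_\infty=\sup|K|$. Notation: $(\alpha_n)$ is a sequence of numbers larger than $1$, depending only on $n$, with $\alpha_n\to+\infty$; $\mathcal V_n(x_0)=[x_0-2A/\alpha_n,\,x_0+2A/\alpha_n]$; $\|u\|_{\infty,I}=\sup_{t\in I}|u(t)|$; $\gamma=\inf_{t\in\mathcal V_n(x_0)}|g(t)|$ (positive, since $g\ge\theta>0$ on $[0,1]$); $\hat\gamma=\inf_{t\in\mathcal V_n(x_0)}|\hat g(t)|$. Estimators: $w(\vartheta,y)=\frac1{1-\vartheta}\big(1-\frac{\vartheta}{y}\big)$ and $$\hat f_h(x_0)=\frac1n\sum_{i=1}^n w(\tilde\theta_n,\hat g(X_i))K_h(x_0-X_i).$$ Assumptions: (A1) $f$ is uniformly bounded on $\mathcal V_n(x_0)$ for some $n$: $\|f\|_{\infty,\mathcal V_n(x_0)}<\infty$.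 (A2) $\hat\gamma>0$ almost surely. (A3) For all $\nu>0$, $\mathbb P\big(\sup_{t\in\mathcal V_n(x_0)}\big|\frac{\hat g(t)-g(t)}{\hat g(t)}\big|>\nu\big)\le C_{g,\nu}\exp\{-(\log n)^{3/2}\}$, with $C_{g,\nu}$ a constant depending only on $g$ and $\nu$. (A4) $\tilde\theta_n\in[\delta/2,1-\delta/2]$ almost surely, for a fixed $\delta\in(0,1)$. (A5) (for a bandwidth $h>0$) almost surely, $\alpha_n\le\frac1h$ and $\frac1h\le\min\big\{\frac{\hat\gamma n}{\log^3 n},\,n\big\}$. Bandwidth selection: $\mathcal H_n$ is a finite family of bandwidths $h>0$ with cardinality at most $n$. With $\kappa>0$ a tuning parameter and $h,h'\in\mathcal H_n$, put $$V(x_0,h)=\frac{\kappa\|K\|_1^2\|K\|_2^2\|g\|_{\infty,\mathcal V_n(x_0)}}{\hat\gamma^2nh}\log n,\qquad \hat f_{h,h'}(x_0)=\frac1n\sum_{i=1}^n w(\tilde\theta_n,\hat g(X_i))(K_h\star K_{h'})(x_0-X_i),$$ $$A(x_0,h)=\max_{h'\in\mathcal H_n}\big\{(\hat f_{h,h'}(x_0)-\hat f_{h'}(x_0))^2-V(x_0,h')\big\}_+,\qquad \hat h(x_0)=\operatorname*{argmin}_{h\in\mathcal H_n}\{A(x_0,h)+V(x_0,h)\},$$ and $\hat f(x_0)=\hat f_{\hat h(x_0)}(x_0)$.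
   Formalization: The true θ is assumed to lie in [δ,1−δ]; κ must exceed a threshold depending on δ and the sup-norm of g on V_n(x_0); C_5^* may also depend on κ, and C_6^* also on the sup-norm of g; norms and infima of g and its estimator are taken over V_n(x_0)∩[0,1]. *)

theory Defs
  imports "HOL-Probability.Probability"
begin

text \<open>Densities on \<open>[0,1]\<close> are functions on the real line that vanish outside \<open>[0,1]\<close>, so that
  convolutions with a kernel make sense.\<close>

definition unit_density :: "(real \<Rightarrow> real) \<Rightarrow> bool" where
  "unit_density f \<longleftrightarrow> f \<in> borel_measurable borel \<and> (\<forall>x. 0 \<le> f x) \<and> (\<forall>x. x \<notin> {0..1} \<longrightarrow> f x = 0) \<and>
     (\<integral>\<^sup>+x. ennreal (f x) \<partial>lborel) = 1"

definition mixture :: "real \<Rightarrow> (real \<Rightarrow> real) \<Rightarrow> real \<Rightarrow> real" where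
  "mixture \<theta> f x = (if x \<in> {0..1} then \<theta> + (1 - \<theta>) * f x else 0)"

definition obs_law :: "real \<Rightarrow> (real \<Rightarrow> real) \<Rightarrow> real measure" where
  "obs_law \<theta> f = density lborel (\<lambda>x. ennreal (mixture \<theta> f x))"

definition sample_law :: "real \<Rightarrow> (real \<Rightarrow> real) \<Rightarrow> nat \<Rightarrow> (nat \<Rightarrow> real) measure" where
  "sample_law \<theta> f n = PiM {1..2*n} (\<lambda>_. obs_law \<theta> f)"

text \<open>Preliminary estimators are functions of the second half of the sample only; being applied to
  \<open>second_half n X\<close>, they are automatically independent of \<open>X 1, \<dots>, X n\<close>.\<close>

definition second_half :: "nat \<Rightarrow> (nat \<Rightarrow> real) \<Rightarrow> nat \<Rightarrow> real" where
  "second_half n X = restrict X {n+1..2*n}"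

abbreviation half_space :: "nat \<Rightarrow> (nat \<Rightarrow> real) measure" where
  "half_space n \<equiv> PiM {n+1..2*n} (\<lambda>_. borel)"

definition Lp_norm :: "real \<Rightarrow> (real \<Rightarrow> real) \<Rightarrow> real" where
  "Lp_norm p u = (LINT x|lborel. \<bar>u x\<bar> powr p) powr (1 / p)"

definition sup_norm :: "real set \<Rightarrow> (real \<Rightarrow> real) \<Rightarrow> real" where
  "sup_norm I u = (SUP t\<in>I. \<bar>u t\<bar>)"

text \<open>The sup-norm with values in \<open>[0,\<infinity>]\<close>, for functions that are not assumed to be bounded.\<close>

definition esup_norm :: "real set \<Rightarrow> (real \<Rightarrow> real) \<Rightarrow> ennreal" where
  "esup_norm I u = (SUP t\<in>I. ennreal \<bar>u t\<bar>)"

definition inf_abs :: "real set \<Rightarrow> (real \<Rightarrow> real) \<Rightarrow> real" where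
  "inf_abs I u = (INF t\<in>I. \<bar>u t\<bar>)"

definition smoothing_kernel :: "(real \<Rightarrow> real) \<Rightarrow> real \<Rightarrow> bool" where
  "smoothing_kernel K A \<longleftrightarrow> 0 < A \<and> K \<in> borel_measurable borel \<and> integrable lborel K \<and> bounded (range K) \<and>
     (\<forall>x. x \<notin> {-A..A} \<longrightarrow> K x = 0) \<and> (LINT x|lborel. K x) = 1 \<and>
     integrable lborel (\<lambda>x. (K x)\<^sup>2)"

definition scaled :: "(real \<Rightarrow> real) \<Rightarrow> real \<Rightarrow> real \<Rightarrow> real" where
  "scaled K h x = K (x / h) / h"

definition conv :: "(real \<Rightarrow> real) \<Rightarrow> (real \<Rightarrow> real) \<Rightarrow> real \<Rightarrow> real" where
  "conv u v x = (LINT t|lborel. u (x - t) * v t)"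

text \<open>The neighbourhood of the estimation point, with \<open>a = \<alpha> n\<close>. The functions \<open>g\<close> and its estimator
  live on \<open>[0,1]\<close>, so for them suprema and infima run over \<open>nbhd01\<close> (in particular the infimum
  of \<open>g\<close> is at least \<open>\<theta> > 0\<close> also when \<open>x0\<close> is close to 0 or 1); the bias \<open>K\<^sub>h \<star> f - f\<close> lives on
  the real line and is taken over all of \<open>nbhd\<close>. As \<open>f\<close> vanishes outside \<open>[0,1]\<close>, both
  sets give the same sup-norm of \<open>f\<close>.\<close>

definition nbhd :: "real \<Rightarrow> real \<Rightarrow> real \<Rightarrow> real set" where
  "nbhd A a x0 = {x0 - 2 * A / a .. x0 + 2 * A / a}"

definition nbhd01 :: "real \<Rightarrow> real \<Rightarrow> real \<Rightarrow> real set" where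
  "nbhd01 A a x0 = nbhd A a x0 \<inter> {0..1}"

definition weight :: "real \<Rightarrow> real \<Rightarrow> real" where
  "weight \<tau> y = 1 / (1 - \<tau>) * (1 - \<tau> / y)"

text \<open>In the following definitions \<open>\<tau>\<close> and \<open>gh\<close> are the realised values of the estimators of
  \<open>\<theta>\<close> and \<open>g\<close>.\<close>

definition weighted_est ::
  "nat \<Rightarrow> real \<Rightarrow> (real \<Rightarrow> real) \<Rightarrow> (nat \<Rightarrow> real) \<Rightarrow> real \<Rightarrow> (real \<Rightarrow> real) \<Rightarrow> real" where
  "weighted_est n \<tau> gh X x0 L = 1 / real n * (\<Sum>i=1..n. weight \<tau> (gh (X i)) * L (x0 - X i))"

definition f_est ::
  "(real \<Rightarrow> real) \<Rightarrow> nat \<Rightarrow> real \<Rightarrow> (real \<Rightarrow> real) \<Rightarrow> (nat \<Rightarrow> real) \<Rightarrow> real \<Rightarrow> real \<Rightarrow> real" where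
  "f_est K n \<tau> gh X x0 h = weighted_est n \<tau> gh X x0 (scaled K h)"

definition f_est2 ::
  "(real \<Rightarrow> real) \<Rightarrow> nat \<Rightarrow> real \<Rightarrow> (real \<Rightarrow> real) \<Rightarrow> (nat \<Rightarrow> real) \<Rightarrow> real \<Rightarrow> real \<Rightarrow> real \<Rightarrow> real" where
  "f_est2 K n \<tau> gh X x0 h h' = weighted_est n \<tau> gh X x0 (conv (scaled K h) (scaled K h'))"

text \<open>Here \<open>G\<close> is the sup-norm of \<open>g\<close> and \<open>\<gamma>h\<close> the infimum of its estimator.\<close>

definition V_pen :: "(real \<Rightarrow> real) \<Rightarrow> real \<Rightarrow> nat \<Rightarrow> real \<Rightarrow> real \<Rightarrow> real \<Rightarrow> real" where
  "V_pen K \<kappa> n G \<gamma>h h =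
     \<kappa> * (Lp_norm 1 K)\<^sup>2 * (Lp_norm 2 K)\<^sup>2 * G / (\<gamma>h\<^sup>2 * real n * h) * ln (real n)"

definition A_term ::
  "(real \<Rightarrow> real) \<Rightarrow> real \<Rightarrow> real set \<Rightarrow> nat \<Rightarrow> real \<Rightarrow> real \<Rightarrow> real \<Rightarrow> (real \<Rightarrow> real) \<Rightarrow> (nat \<Rightarrow> real)
     \<Rightarrow> real \<Rightarrow> real \<Rightarrow> real" where
  "A_term K \<kappa> H n G \<gamma>h \<tau> gh X x0 h =
     Max ((\<lambda>h'. max 0 ((f_est2 K n \<tau> gh X x0 h h' - f_est K n \<tau> gh X x0 h')\<^sup>2 - V_pen K \<kappa> n G \<gamma>h h')) ` H)"

text \<open>A measurable choice of a minimiser of \<open>A + V\<close> over \<open>H\<close>; ties may be broken arbitrarily.\<close>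

definition selected_bandwidth ::
  "(real \<Rightarrow> real) \<Rightarrow> real \<Rightarrow> real set \<Rightarrow> nat \<Rightarrow> real \<Rightarrow> real set \<Rightarrow> ((nat \<Rightarrow> real) \<Rightarrow> real)
     \<Rightarrow> ((nat \<Rightarrow> real) \<Rightarrow> real \<Rightarrow> real) \<Rightarrow> real \<Rightarrow> ((nat \<Rightarrow> real) \<Rightarrow> real) \<Rightarrow> bool" where
  "selected_bandwidth K \<kappa> H n G I \<theta>est gest x0 hsel \<longleftrightarrow>
     hsel \<in> borel_measurable (PiM {1..2*n} (\<lambda>_. borel)) \<and>
     (\<forall>X \<in> space (PiM {1..2*n} (\<lambda>_. borel)).
        let \<tau> = \<theta>est (second_half n X); gh = gest (second_half n X); \<gamma>h = inf_abs I gh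
        in is_arg_min (\<lambda>h. A_term K \<kappa> H n G \<gamma>h \<tau> gh X x0 h + V_pen K \<kappa> n G \<gamma>h h)
             (\<lambda>h. h \<in> H) (hsel X))"

text \<open>The estimators, and the suprema and infima over uncountable sets of points occurring in the
  assumptions and the risk bound, are random variables.\<close>

definition preliminary_estimators ::
  "nat \<Rightarrow> real set \<Rightarrow> (real \<Rightarrow> real) \<Rightarrow> ((nat \<Rightarrow> real) \<Rightarrow> real) \<Rightarrow> ((nat \<Rightarrow> real) \<Rightarrow> real \<Rightarrow> real) \<Rightarrow> bool"
  where
  "preliminary_estimators n I g \<theta>est gest \<longleftrightarrow>
     \<theta>est \<in> borel_measurable (half_space n) \<and>
     (\<lambda>(z, t). gest z t) \<in> borel_measurable (half_space n \<Otimes>\<^sub>M borel) \<and>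
     (\<lambda>z. inf_abs I (gest z)) \<in> borel_measurable (half_space n) \<and>
     (\<lambda>z. esup_norm I (\<lambda>t. (gest z t - g t) / gest z t)) \<in> borel_measurable (half_space n) \<and>
     (\<lambda>z. esup_norm I (\<lambda>t. gest z t - g t)) \<in> borel_measurable (half_space n)"

definition assm_A1 :: "(real \<Rightarrow> real) \<Rightarrow> real set \<Rightarrow> bool" where
  "assm_A1 f I \<longleftrightarrow> bdd_above ((\<lambda>t. \<bar>f t\<bar>) ` I)"

definition assm_A2 ::
  "(nat \<Rightarrow> real) measure \<Rightarrow> nat \<Rightarrow> real set \<Rightarrow> ((nat \<Rightarrow> real) \<Rightarrow> real \<Rightarrow> real) \<Rightarrow> bool" where
  "assm_A2 P n I gest \<longleftrightarrow> (AE X in P. 0 < inf_abs I (gest (second_half n X)))"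

definition assm_A3 ::
  "(nat \<Rightarrow> real) measure \<Rightarrow> nat \<Rightarrow> real set \<Rightarrow> (real \<Rightarrow> real) \<Rightarrow> ((nat \<Rightarrow> real) \<Rightarrow> real \<Rightarrow> real)
     \<Rightarrow> (real \<Rightarrow> real) \<Rightarrow> bool" where
  "assm_A3 P n I g gest C \<longleftrightarrow>
     (\<forall>\<nu>>0. measure P {X \<in> space P. esup_norm I (\<lambda>t. (gest (second_half n X) t - g t) /
                                      gest (second_half n X) t) > ennreal \<nu>}
            \<le> C \<nu> * exp (- (ln (real n) powr (3/2))))"

definition assm_A4 ::
  "(nat \<Rightarrow> real) measure \<Rightarrow> nat \<Rightarrow> real \<Rightarrow> ((nat \<Rightarrow> real) \<Rightarrow> real) \<Rightarrow> bool" where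
  "assm_A4 P n \<delta> \<theta>est \<longleftrightarrow> (AE X in P. \<theta>est (second_half n X) \<in> {\<delta>/2 .. 1 - \<delta>/2})"

definition assm_A5 ::
  "(nat \<Rightarrow> real) measure \<Rightarrow> nat \<Rightarrow> real set \<Rightarrow> ((nat \<Rightarrow> real) \<Rightarrow> real \<Rightarrow> real) \<Rightarrow> real \<Rightarrow> real \<Rightarrow> bool" where
  "assm_A5 P n I gest a h \<longleftrightarrow>
     (AE X in P. a \<le> 1 / h \<and>
        1 / h \<le> min (inf_abs I (gest (second_half n X)) * real n / (ln (real n))^3) (real n))"

end

(* Conditionally on the second half of the sample, the weighted kernel estimators are averages of
   n independent bounded variables whose mean is the kernel smoothing of the plug-in function
   t \<mapsto> weight \<tau> (gh t) * g t. This function differs from f by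
   \<tau>/(1-\<tau>) * (gh - g)/gh + (g - 1) * (\<tau> - \<theta>)/((1-\<tau>)(1-\<theta>)), which accounts for the two
   preliminary-estimation terms of the risk bound. With \<kappa> large enough, Bernstein's inequality keeps
   every squared deviation below V/6 with probability 1 - 2 n^-12: the condition 1/h \<le> \<gamma>h n/log^3 n makes
   the linear term of Bernstein's exponent harmless as soon as log n \<ge> ||K||_inf/||K||_2. Off these
   exceptional events, and off the event where |gh - g| \<le> |gh|/2 fails, the Goldenshluger-Lepski
   comparison is purely deterministic. On the exceptional events the squared error is at most of
   order n^4, whereas n^6 exp(-(log n)^(3/2)) stays bounded. *)

theory Submission
  imports Defs
begin

section \<open>Kernels and convolutions\<close>

text \<open>The density f is bounded only on the neighbourhood \<open>J\<close> of radius
  2A/\<alpha> around x0, and the estimate of g is controlled only on \<open>I\<close>, the part of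
  \<open>J\<close> inside [0,1]; so everything is localized. A bandwidth satisfies A h <=
  A/\<alpha>, hence even two smoothings in a row, started at x0, do not leave \<open>J\<close>, and
  f and the plug-in function can be replaced by versions cut off to \<open>I\<close>. These are
  bounded with bounded support, a class stable under shifts, products and convolutions, which
  settles the integrability questions. The comparison of bandwidths needs only the pairs formed by
  one fixed oracle bandwidth k and each h', because the double estimator is symmetric in its
  bandwidths. The kernel K_h' and its convolution with K_k obey the same sup and L2 bounds, at the
  price of the factor ||K||_1^2 in V. So one tail bound serves both, and the union runs over at most
  2n deviation events.\<close>

definition bounded_supp :: "real \<Rightarrow> real \<Rightarrow> (real \<Rightarrow> real) \<Rightarrow> bool" where
  "bounded_supp B R u \<longleftrightarrow> u \<in> borel_measurable borel \<and> (\<forall>x. \<bar>u x\<bar> \<le> B) \<and> (\<forall>x. R < \<bar>x\<bar> \<longrightarrow> u x = 0)"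

lemma bounded_suppD:
  assumes "bounded_supp B R u"
  shows "u \<in> borel_measurable borel" "\<bar>u x\<bar> \<le> B" "R < \<bar>x\<bar> \<Longrightarrow> u x = 0" "0 \<le> B"
  using assms abs_ge_zero order_trans unfolding bounded_supp_def by blast+

lemma bounded_supp_integrable:
  assumes "bounded_supp B R u"
  shows "integrable lborel u"
proof -
  have "{- R..R} \<in> sets lborel" "emeasure lborel {- R..R} < \<infinity>"
    by (auto simp: emeasure_lborel_Icc_eq)
  then show ?thesis
    using bounded_suppD[OF assms] by (intro integrableI_bounded_set[of "{- R..R}" _ _ B]) auto
qed

lemma bounded_supp_abs: "bounded_supp B R u \<Longrightarrow> bounded_supp B R (\<lambda>x. \<bar>u x\<bar>)"
  unfolding bounded_supp_def by auto

lemma bounded_supp_square: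
  assumes "bounded_supp B R u" shows "bounded_supp (B\<^sup>2) R (\<lambda>x. (u x)\<^sup>2)"
  using bounded_suppD[OF assms] unfolding bounded_supp_def by (auto intro: abs_le_square_iff[THEN iffD1] simp: abs_le_square_iff)

text \<open>The integrand lives on a bounded rectangle because |x| <= |x - t| + |t|. This is what
  licenses Fubini for convolutions.\<close>

lemma pair_integrable_bounded_supp:
  assumes u: "bounded_supp B R u" and v: "bounded_supp B' R' v"
  shows "integrable (lborel \<Otimes>\<^sub>M lborel) (\<lambda>(x, t). u (x - t) * v t)"
proof -
  have [measurable]: "u \<in> borel_measurable borel" "v \<in> borel_measurable borel"
    using bounded_suppD u v by auto
  let ?S = "{- R - R'..R + R'} \<times> {- R'..R'} :: (real \<times> real) set"
  show ?thesis
  proof (rule integrableI_bounded_set[of ?S _ _ "B * B'"])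
    show "?S \<in> sets (lborel \<Otimes>\<^sub>M lborel)" by measurable
    show "emeasure (lborel \<Otimes>\<^sub>M lborel) ?S < \<infinity>"
      by (subst lborel.emeasure_pair_measure_Times)
         (auto simp: emeasure_lborel_Icc_eq ennreal_mult_less_top)
    show "AE p in lborel \<Otimes>\<^sub>M lborel. p \<in> ?S \<longrightarrow>
        norm (case p of (x, t) \<Rightarrow> u (x - t) * v t) \<le> B * B'"
      using bounded_suppD[OF u] bounded_suppD[OF v] by (auto simp: abs_mult intro!: mult_mono AE_I2)
    show "AE p in lborel \<Otimes>\<^sub>M lborel. p \<notin> ?S \<longrightarrow> (case p of (x, t) \<Rightarrow> u (x - t) * v t) = 0"
    proof (intro AE_I2 impI)
      fix p :: "real \<times> real" assume "p \<notin> ?S"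
      then obtain x t where p: "p = (x, t)" and nS: "(x, t) \<notin> ?S" by (cases p) auto
      have "u (x - t) * v t = 0"
      proof (cases "R' < \<bar>t\<bar>")
        case True then show ?thesis using bounded_suppD[OF v] by simp
      next
        case False
        then have "R < \<bar>x - t\<bar>" using nS by auto
        then show ?thesis using bounded_suppD[OF u] by simp
      qed
      then show "(case p of (x, t) \<Rightarrow> u (x - t) * v t) = 0" by (simp add: p)
    qed
  qed measurable
qed

lemma bounded_supp_shift:
  assumes "bounded_supp B R u" shows "bounded_supp B (R + \<bar>x\<bar>) (\<lambda>t. u (x - t))"
  using assms unfolding bounded_supp_def by auto

lemma bounded_supp_mult:
  assumes u: "bounded_supp B R u" and v: "bounded_supp B' R' v"
  shows "bounded_supp (B * B') R (\<lambda>t. u t * v t)"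
  using bounded_suppD[OF u] bounded_suppD[OF v] unfolding bounded_supp_def
  by (auto simp: abs_mult intro!: mult_mono)

lemma integral_reflect_shift:
  fixes u :: "real \<Rightarrow> real"
  shows "(LINT t|lborel. u (x - t)) = (LINT t|lborel. u t)"
  using lborel_integral_real_affine[of "-1" u x] by simp

lemma integral_shift:
  fixes u :: "real \<Rightarrow> real"
  shows "(LINT x|lborel. u (x - t)) = (LINT x|lborel. u x)"
  using lborel_integral_real_affine[of 1 u "-t"] by simp

lemma conv_commute: "conv u v = conv v u"
proof
  fix x
  show "conv u v x = conv v u x"
    unfolding conv_def using integral_reflect_shift[of "\<lambda>t. u (x - t) * v t" x]
    by (simp add: mult.commute)
qed

text \<open>The mixed estimate ||u||_inf ||v||_1 takes the sup of one factor only. For two scaled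
  kernels this makes the bandwidth of the other one drop out, since rescaling preserves the L1
  norm.\<close>

lemma bounded_supp_conv:
  assumes u: "bounded_supp B R u" and v: "bounded_supp B' R' v"
  shows "bounded_supp (B * (LINT t|lborel. \<bar>v t\<bar>)) (R + R') (conv u v)"
proof -
  have [measurable]: "u \<in> borel_measurable borel" "v \<in> borel_measurable borel"
    using bounded_suppD u v by auto
  have "conv u v \<in> borel_measurable borel"
    unfolding conv_def by (rule lborel.borel_measurable_lebesgue_integral) measurable
  moreover have "\<bar>conv u v x\<bar> \<le> B * (LINT t|lborel. \<bar>v t\<bar>)" for x
  proof -
    have i: "integrable lborel (\<lambda>t. u (x - t) * v t)"
      by (rule bounded_supp_integrable[OF bounded_supp_mult[OF bounded_supp_shift[OF u] v]])
    have "\<bar>conv u v x\<bar> \<le> (LINT t|lborel. \<bar>u (x - t) * v t\<bar>)"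
      unfolding conv_def by (rule integral_abs_bound)
    also have "\<dots> \<le> (LINT t|lborel. B * \<bar>v t\<bar>)"
      using integrable_abs[OF i] bounded_supp_integrable[OF bounded_supp_abs[OF v]] bounded_suppD[OF u]
      by (intro integral_mono) (auto intro!: mult_right_mono simp: abs_mult[of "u _"])
    finally show ?thesis by simp
  qed
  moreover have "conv u v x = 0" if "R + R' < \<bar>x\<bar>" for x
  proof -
    have "u (x - t) * v t = 0" for t
    proof (cases "R' < \<bar>t\<bar>")
      case True then show ?thesis using bounded_suppD[OF v] by simp
    next
      case False
      then have "R < \<bar>x - t\<bar>" using that by auto
      then show ?thesis using bounded_suppD[OF u] by simp
    qed
    then have "(\<lambda>t. u (x - t) * v t) = (\<lambda>_. 0)" by blast
    then show ?thesis unfolding conv_def by (simp only: Bochner_Integration.integral_zero)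
  qed
  ultimately show ?thesis unfolding bounded_supp_def by blast
qed

text \<open>Discriminant argument: the integral of p (q - c)^2 is a nonnegative quadratic in c,
  evaluated at its vertex a/m when the mass m of p is positive.\<close>

lemma weighted_Cauchy_Schwarz:
  fixes p q :: "'a \<Rightarrow> real"
  assumes "integrable M p" "integrable M (\<lambda>x. p x * q x)" "integrable M (\<lambda>x. p x * (q x)\<^sup>2)"
    and p: "\<And>x. 0 \<le> p x"
  shows "(LINT x|M. p x * q x)\<^sup>2 \<le> (LINT x|M. p x) * (LINT x|M. p x * (q x)\<^sup>2)"
proof -
  define m a b where "m = (LINT x|M. p x)" and "a = (LINT x|M. p x * q x)"
    and "b = (LINT x|M. p x * (q x)\<^sup>2)"
  have pos: "0 \<le> b - 2 * c * a + c\<^sup>2 * m" for c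
  proof -
    have "0 \<le> (LINT x|M. p x * (q x - c)\<^sup>2)"
      using p by (intro integral_nonneg_AE) auto
    also have "\<dots> = (LINT x|M. p x * (q x)\<^sup>2 - 2 * c * (p x * q x) + c\<^sup>2 * p x)"
      by (intro Bochner_Integration.integral_cong) (auto simp: power2_eq_square algebra_simps)
    also have "\<dots> = b - 2 * c * a + c\<^sup>2 * m"
      using assms by (simp add: m_def a_def b_def)
    finally show ?thesis .
  qed
  have m0: "0 \<le> m" "0 \<le> b" unfolding m_def b_def using p by (auto intro!: integral_nonneg_AE)
  have "a\<^sup>2 \<le> m * b"
  proof (cases "m = 0")
    case True
    have "a = 0"
    proof (rule ccontr)
      assume "a \<noteq> 0"
      \<comment> \<open>For m = 0 the quadratic degenerates to b - 2 c a, which equals -1 at this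
        c.\<close>
      with pos[of "(b + 1) / (2 * a)"] True show False by simp
    qed
    then show ?thesis using m0 by simp
  next
    case False
    then show ?thesis using pos[of "a / m"] m0 by (simp add: power2_eq_square field_simps)
  qed
  then show ?thesis by (simp add: m_def a_def b_def)
qed

text \<open>Young's inequality for L1 and L2. Cauchy-Schwarz with the weight |u (x - t)| splits off
  one factor ||u||_1; Fubini in x produces the second.\<close>

lemma Young_conv_square:
  assumes u: "bounded_supp B R u" and v: "bounded_supp B' R' v"
  shows "(LINT x|lborel. (conv u v x)\<^sup>2) \<le> (LINT t|lborel. \<bar>u t\<bar>)\<^sup>2 * (LINT t|lborel. (v t)\<^sup>2)"
proof -
  have [measurable]: "u \<in> borel_measurable borel" "v \<in> borel_measurable borel"
    using bounded_suppD u v by auto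
  note ua = bounded_supp_abs[OF u] and v2 = bounded_supp_square[OF v]
  let ?U = "LINT t|lborel. \<bar>u t\<bar>"
  have ptw: "(conv u v x)\<^sup>2 \<le> ?U * conv (\<lambda>x. \<bar>u x\<bar>) (\<lambda>x. (v x)\<^sup>2) x" for x
  proof -
    have "\<bar>conv u v x\<bar> \<le> (LINT t|lborel. \<bar>u (x - t) * v t\<bar>)"
      unfolding conv_def by (rule integral_abs_bound)
    then have "(conv u v x)\<^sup>2 \<le> (LINT t|lborel. \<bar>u (x - t)\<bar> * \<bar>v t\<bar>)\<^sup>2"
      by (simp add: abs_mult abs_le_square_iff[symmetric])
    also have "\<dots> \<le> (LINT t|lborel. \<bar>u (x - t)\<bar>) * (LINT t|lborel. \<bar>u (x - t)\<bar> * \<bar>v t\<bar>\<^sup>2)"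
      using bounded_supp_integrable[OF bounded_supp_shift[OF ua]] bounded_supp_integrable[OF bounded_supp_mult[OF bounded_supp_shift[OF ua] bounded_supp_abs[OF v]]]
        bounded_supp_integrable[OF bounded_supp_mult[OF bounded_supp_shift[OF ua] v2]]
      by (intro weighted_Cauchy_Schwarz) auto
    finally show ?thesis
      using integral_reflect_shift[of "\<lambda>t. \<bar>u t\<bar>" x] by (simp add: conv_def)
  qed
  have "(LINT x|lborel. (conv u v x)\<^sup>2) \<le> (LINT x|lborel. ?U * conv (\<lambda>x. \<bar>u x\<bar>) (\<lambda>x. (v x)\<^sup>2) x)"
    using bounded_supp_integrable[OF bounded_supp_square[OF bounded_supp_conv[OF u v]]] bounded_supp_integrable[OF bounded_supp_conv[OF ua v2]] ptw
    by (intro integral_mono) auto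
  also have "\<dots> = ?U * (LINT x|lborel. LINT t|lborel. \<bar>u (x - t)\<bar> * (v t)\<^sup>2)"
    by (simp add: conv_def)
  also have "(LINT x|lborel. LINT t|lborel. \<bar>u (x - t)\<bar> * (v t)\<^sup>2)
      = (LINT t|lborel. LINT x|lborel. \<bar>u (x - t)\<bar> * (v t)\<^sup>2)"
    by (rule lborel_pair.Fubini_integral[symmetric, of "\<lambda>x t. \<bar>u (x - t)\<bar> * (v t)\<^sup>2"])
       (rule pair_integrable_bounded_supp[OF ua v2])
  also have "\<dots> = (LINT t|lborel. ?U * (v t)\<^sup>2)"
    using integral_shift[of "\<lambda>x. \<bar>u x\<bar>"] by simp
  finally show ?thesis by (simp add: power2_eq_square mult.assoc)
qed

text \<open>Associativity and commutativity in one step, in the form needed for the bias: a doubly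
  smoothed function can be read as K_h' acting on K_h acting on w.\<close>

lemma conv_conv_eq:
  assumes u: "bounded_supp B R u" and v: "bounded_supp B' R' v" and w: "bounded_supp B'' R'' w"
  shows "conv (conv u v) w x = conv v (conv u w) x"
proof -
  have [measurable]: "u \<in> borel_measurable borel" "v \<in> borel_measurable borel" "w \<in> borel_measurable borel"
    using bounded_suppD u v w by auto
  \<comment> \<open>After substituting x - t for t the variable s occurs in u only, so the inner
    integral over s becomes \<open>conv u w t\<close>.\<close>
  have eq: "conv u v (x - s) = (LINT t|lborel. u (t - s) * v (x - t))" for s
    unfolding conv_def using integral_reflect_shift[of "\<lambda>t. u (x - s - t) * v t" x]
    by (simp add: algebra_simps)
  have int: "integrable (lborel \<Otimes>\<^sub>M lborel) (\<lambda>(t, s). u (t - s) * v (x - t) * w s)"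
  proof (rule Bochner_Integration.integrable_bound)
    show "integrable (lborel \<Otimes>\<^sub>M lborel) (\<lambda>p. B' * (case p of (t, s) \<Rightarrow> u (t - s) * w s))"
      using pair_integrable_bounded_supp[OF u w] by simp
    show "AE p in lborel \<Otimes>\<^sub>M lborel. norm (case p of (t, s) \<Rightarrow> u (t - s) * v (x - t) * w s)
        \<le> norm (B' * (case p of (t, s) \<Rightarrow> u (t - s) * w s))"
    proof (intro AE_I2)
      fix p :: "real \<times> real"
      obtain a b where p: "p = (a, b)" by (cases p)
      have "\<bar>v (x - a)\<bar> * \<bar>u (a - b) * w b\<bar> \<le> B' * \<bar>u (a - b) * w b\<bar>"
        by (intro mult_right_mono bounded_suppD(2)[OF v]) simp
      then show "norm (case p of (t, s) \<Rightarrow> u (t - s) * v (x - t) * w s)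
          \<le> norm (B' * (case p of (t, s) \<Rightarrow> u (t - s) * w s))"
        using bounded_suppD(4)[OF v] by (simp add: p abs_mult mult_ac)
    qed
  qed measurable
  have "conv (conv u v) w x = (LINT s|lborel. LINT t|lborel. u (t - s) * v (x - t) * w s)"
    unfolding conv_def[of "conv u v"] by (simp add: eq)
  also have "\<dots> = (LINT t|lborel. LINT s|lborel. u (t - s) * v (x - t) * w s)"
    by (rule lborel_pair.Fubini_integral) (use int in simp)
  also have "\<dots> = (LINT t|lborel. v (x - t) * (LINT s|lborel. u (t - s) * w s))"
    by (subst Bochner_Integration.integral_mult_right_zero[symmetric]) (simp add: mult_ac)
  finally show ?thesis by (simp add: conv_def)
qed

section \<open>Bernstein's inequality and kernel norms\<close>

lemma exp_le_quadratic:
  fixes x :: real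
  assumes "\<bar>x\<bar> \<le> 1"
  shows "exp x \<le> 1 + x + x\<^sup>2"
proof (cases "0 \<le> x")
  case True
  then show ?thesis using exp_bound[of x] assms by simp
next
  case False
  define y where "y = - x"
  have y: "0 \<le> y" using False by (simp add: y_def)
  have q: "0 < 1 + y + y\<^sup>2 / 2" using y by (simp add: add_pos_nonneg)
  \<comment> \<open>On the negative side the claim is 1 <= (1 - y + y^2) exp y. Replacing exp y by
    its quadratic Taylor polynomial makes the product collapse to this sum.\<close>
  have "1 \<le> 1 + y\<^sup>2 / 2 + y^3 / 2 + y^4 / 2" using y by simp
  also have "\<dots> = (1 - y + y\<^sup>2) * (1 + y + y\<^sup>2 / 2)"
    by (simp add: power2_eq_square power3_eq_cube power4_eq_xxxx field_simps)
  also have "\<dots> \<le> (1 - y + y\<^sup>2) * exp y"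
  proof (rule mult_left_mono[OF exp_lower_Taylor_quadratic[OF y]])
    have "0 \<le> (y - 1/2)\<^sup>2 + 3/4" by simp
    then show "0 \<le> 1 - y + y\<^sup>2" by (simp add: power2_eq_square algebra_simps)
  qed
  finally have "exp (- y) \<le> 1 - y + y\<^sup>2"
    by (simp add: exp_minus field_simps)
  then show ?thesis by (simp add: y_def)
qed

text \<open>The linear term of the quadratic majorant integrates to zero, and 1 + t^2 v <= exp (t^2
  v) gives a form that multiplies well over a sample.\<close>

lemma (in prob_space) exp_moment_bounded:
  fixes Y :: "'a \<Rightarrow> real" and c t v :: real
  assumes [measurable]: "Y \<in> borel_measurable M" and Y: "\<And>x. x \<in> space M \<Longrightarrow> \<bar>Y x\<bar> \<le> c"
    and mean: "expectation Y = 0" and var: "expectation (\<lambda>x. (Y x)\<^sup>2) \<le> v"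
    and t: "0 \<le> t" "t * c \<le> 1"
  shows "(\<integral>\<^sup>+x. ennreal (exp (t * Y x)) \<partial>M) \<le> ennreal (exp (t\<^sup>2 * v))"
proof -
  have tY: "\<bar>t * Y x\<bar> \<le> 1" if "x \<in> space M" for x
    using mult_left_mono[OF Y[OF that] t(1)] t by (simp add: abs_mult)
  have i1: "integrable M Y" using Y by (intro integrable_const_bound[where B = c]) auto
  have i2: "integrable M (\<lambda>x. (Y x)\<^sup>2)"
    using power_mono[OF Y, of _ 2] by (intro integrable_const_bound[where B = "c\<^sup>2"]) auto
  have "(\<integral>\<^sup>+x. ennreal (exp (t * Y x)) \<partial>M) \<le> (\<integral>\<^sup>+x. ennreal (1 + t * Y x + t\<^sup>2 * (Y x)\<^sup>2) \<partial>M)"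
    using exp_le_quadratic[OF tY] by (intro nn_integral_mono ennreal_leI) (simp add: power_mult_distrib)
  also have "\<dots> = ennreal (expectation (\<lambda>x. 1 + t * Y x + t\<^sup>2 * (Y x)\<^sup>2))"
  proof (rule nn_integral_eq_integral)
    show "AE x in M. 0 \<le> 1 + t * Y x + t\<^sup>2 * (Y x)\<^sup>2"
      using order_trans[OF exp_ge_zero exp_le_quadratic[OF tY]]
      by (intro AE_I2) (simp add: power_mult_distrib)
  qed (use i1 i2 in simp)
  also have "\<dots> \<le> ennreal (1 + t\<^sup>2 * v)"
    using i1 i2 mean var by (intro ennreal_leI) (simp add: mult_left_mono prob_space)
  also have "\<dots> \<le> ennreal (exp (t\<^sup>2 * v))"
    using exp_ge_add_one_self by (intro ennreal_leI)
  finally show ?thesis .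
qed

text \<open>Chernoff's method with t left free; its choice is postponed until the penalty is known.
  The condition t v <= l/2 lets the variance term consume at most half of the exponent, whence the
  factor 1/2 in the bound.\<close>

lemma (in prob_space) Bernstein_sum_ge:
  fixes Y :: "'a \<Rightarrow> real" and c t v l :: real
  assumes [measurable]: "Y \<in> borel_measurable M" and "\<And>x. x \<in> space M \<Longrightarrow> \<bar>Y x\<bar> \<le> c"
    and "expectation Y = 0" and "expectation (\<lambda>x. (Y x)\<^sup>2) \<le> v"
    and t: "0 \<le> t" "t * c \<le> 1" and tv: "t * v \<le> l / 2" and [simp]: "finite I"
  shows "emeasure (PiM I (\<lambda>_. M)) {x \<in> space (PiM I (\<lambda>_. M)). real (card I) * l \<le> (\<Sum>i\<in>I. Y (x i))}
    \<le> ennreal (exp (- (real (card I) * t * l / 2)))"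
proof -
  have moment: "(\<integral>\<^sup>+x. ennreal (exp (t * Y x)) \<partial>M) \<le> ennreal (exp (t\<^sup>2 * v))"
    using assms by (intro exp_moment_bounded)
  interpret product_prob_space "\<lambda>_. M" I
    by (simp add: product_prob_space_def product_prob_space_axioms_def product_sigma_finite_def
        prob_space_axioms sigma_finite_measure_axioms)
  let ?P = "PiM I (\<lambda>_. M)" and ?m = "real (card I)"
  let ?E = "{x \<in> space ?P. ?m * l \<le> (\<Sum>i\<in>I. Y (x i))}"
  have "emeasure ?P ?E = (\<integral>\<^sup>+x. indicator ?E x \<partial>?P)" by simp
  also have "\<dots> \<le> (\<integral>\<^sup>+x. ennreal (exp (- (t * ?m * l))) * (\<Prod>i\<in>I. ennreal (exp (t * Y (x i)))) \<partial>?P)"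
  proof (intro nn_integral_mono)
    fix x
    have "(\<Prod>i\<in>I. ennreal (exp (t * Y (x i)))) = ennreal (exp (t * (\<Sum>i\<in>I. Y (x i))))"
      by (simp add: prod_ennreal exp_sum sum_distrib_left)
    then have "ennreal (exp (- (t * ?m * l))) * (\<Prod>i\<in>I. ennreal (exp (t * Y (x i))))
        = ennreal (exp (t * ((\<Sum>i\<in>I. Y (x i)) - ?m * l)))"
      by (simp add: ennreal_mult[symmetric] exp_add[symmetric] algebra_simps)
    moreover have "1 \<le> exp (t * ((\<Sum>i\<in>I. Y (x i)) - ?m * l))" if "x \<in> ?E"
      using that t by simp
    ultimately show "indicator ?E x \<le> ennreal (exp (- (t * ?m * l))) * (\<Prod>i\<in>I. ennreal (exp (t * Y (x i))))"
      by (auto simp: indicator_def)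
  qed
  also have "\<dots> = ennreal (exp (- (t * ?m * l))) * (\<Prod>i\<in>I. \<integral>\<^sup>+x. ennreal (exp (t * Y x)) \<partial>M)"
    by (subst nn_integral_cmult, simp,
        subst product_nn_integral_prod[where f = "\<lambda>_ y. ennreal (exp (t * Y y))"]) simp_all
  also have "\<dots> \<le> ennreal (exp (- (t * ?m * l))) * (\<Prod>i\<in>I. ennreal (exp (t\<^sup>2 * v)))"
    using moment by (intro mult_left_mono prod_mono_ennreal) auto
  also have "\<dots> = ennreal (exp (- (t * ?m * l) + ?m * (t\<^sup>2 * v)))"
    by (simp add: ennreal_mult[symmetric] ennreal_power exp_of_nat_mult[symmetric] exp_add[symmetric])
  also have "\<dots> \<le> ennreal (exp (- (?m * t * l / 2)))"
  proof -
    have "?m * t * (t * v) \<le> ?m * t * (l / 2)"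
      using tv t by (intro mult_left_mono) auto
    then show ?thesis by (intro ennreal_leI) (simp add: power2_eq_square mult_ac)
  qed
  finally show ?thesis .
qed

text \<open>Centring at most doubles the sup bound, hence the constraint 2 t b <= 1, and does not
  increase the second moment. The factor 2 in the probability pays for the two signs of the
  deviation.\<close>

lemma (in prob_space) Bernstein_mean:
  fixes \<phi> :: "'a \<Rightarrow> real" and b t v l :: real
  assumes [measurable]: "\<phi> \<in> borel_measurable M" and b: "\<And>x. x \<in> space M \<Longrightarrow> \<bar>\<phi> x\<bar> \<le> b"
    and v: "expectation (\<lambda>x. (\<phi> x)\<^sup>2) \<le> v"
    and t: "0 \<le> t" "2 * t * b \<le> 1" and tv: "t * v \<le> l / 2" and n: "0 < n"
  shows "emeasure (PiM {1..n} (\<lambda>_. M)) {x \<in> space (PiM {1..n} (\<lambda>_. M)).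
      l \<le> \<bar>1 / real n * (\<Sum>i=1..n. \<phi> (x i)) - expectation \<phi>\<bar>}
    \<le> ennreal (2 * exp (- (real n * t * l / 2)))"
proof -
  let ?P = "PiM {1..n} (\<lambda>_. M)"
  define m where "m = expectation \<phi>"
  have i1: "integrable M \<phi>" using b by (intro integrable_const_bound[where B = b]) auto
  have i2: "integrable M (\<lambda>x. (\<phi> x)\<^sup>2)"
    using power_mono[OF b, of _ 2] by (intro integrable_const_bound[where B = "b\<^sup>2"]) auto
  have "\<bar>m\<bar> \<le> expectation (\<lambda>x. \<bar>\<phi> x\<bar>)" unfolding m_def by (rule integral_abs_bound)
  also have "\<dots> \<le> expectation (\<lambda>_. b)" using i1 b by (intro integral_mono) auto
  finally have mb: "\<bar>m\<bar> \<le> b" by (simp add: prob_space)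
  have dev: "emeasure ?P {x \<in> space ?P. real n * l \<le> (\<Sum>i=1..n. s * (\<phi> (x i) - m))}
      \<le> ennreal (exp (- (real n * t * l / 2)))" if s: "s = 1 \<or> s = -1" for s :: real
  proof -
    have "emeasure ?P {x \<in> space ?P. real (card {1..n}) * l \<le> (\<Sum>i\<in>{1..n}. s * (\<phi> (x i) - m))}
      \<le> ennreal (exp (- (real (card {1..n}) * t * l / 2)))"
    proof (rule Bernstein_sum_ge[where Y = "\<lambda>x. s * (\<phi> x - m)" and c = "2 * b" and v = v])
      show "\<bar>s * (\<phi> x - m)\<bar> \<le> 2 * b" if "x \<in> space M" for x
        using b[OF that] mb s by (auto simp: abs_mult)
      show "expectation (\<lambda>x. s * (\<phi> x - m)) = 0"
        using i1 by (simp add: m_def prob_space)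
      have "(\<lambda>x. (s * (\<phi> x - m))\<^sup>2) = (\<lambda>x. (\<phi> x)\<^sup>2 - 2 * m * \<phi> x + m\<^sup>2)"
        using s by (auto simp: fun_eq_iff power2_eq_square algebra_simps)
      then have "expectation (\<lambda>x. (s * (\<phi> x - m))\<^sup>2) = expectation (\<lambda>x. (\<phi> x)\<^sup>2) - m\<^sup>2"
        using i1 i2 by (simp add: m_def[symmetric] prob_space power2_eq_square)
      then show "expectation (\<lambda>x. (s * (\<phi> x - m))\<^sup>2) \<le> v"
        using v zero_le_power2[of m] by linarith
    qed (use t tv in \<open>auto simp: mult_ac\<close>)
    then show ?thesis by simp
  qed
  have "{x \<in> space ?P. l \<le> \<bar>1 / real n * (\<Sum>i=1..n. \<phi> (x i)) - m\<bar>}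
      \<subseteq> {x \<in> space ?P. real n * l \<le> (\<Sum>i=1..n. 1 * (\<phi> (x i) - m))}
       \<union> {x \<in> space ?P. real n * l \<le> (\<Sum>i=1..n. (-1) * (\<phi> (x i) - m))}"
  proof
    fix x assume "x \<in> {x \<in> space ?P. l \<le> \<bar>1 / real n * (\<Sum>i=1..n. \<phi> (x i)) - m\<bar>}"
    then have x: "x \<in> space ?P" and "l \<le> \<bar>1 / real n * (\<Sum>i=1..n. \<phi> (x i)) - m\<bar>" by auto
    then have "real n * l \<le> real n * \<bar>1 / real n * (\<Sum>i=1..n. \<phi> (x i)) - m\<bar>"
      by (intro mult_left_mono) auto
    also have "\<dots> = \<bar>real n * (1 / real n * (\<Sum>i=1..n. \<phi> (x i)) - m)\<bar>" by (simp add: abs_mult)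
    also have "real n * (1 / real n * (\<Sum>i=1..n. \<phi> (x i)) - m) = (\<Sum>i=1..n. \<phi> (x i) - m)"
      using n by (simp add: sum_subtractf algebra_simps)
    finally show "x \<in> {x \<in> space ?P. real n * l \<le> (\<Sum>i=1..n. 1 * (\<phi> (x i) - m))}
       \<union> {x \<in> space ?P. real n * l \<le> (\<Sum>i=1..n. (-1) * (\<phi> (x i) - m))}"
      using x by (auto simp: sum_negf[symmetric] abs_if simp del: sum_negf split: if_splits)
  qed
  moreover have "{x \<in> space ?P. real n * l \<le> (\<Sum>i=1..n. s * (\<phi> (x i) - m))} \<in> sets ?P" for s
    by measurable
  ultimately have "emeasure ?P {x \<in> space ?P. l \<le> \<bar>1 / real n * (\<Sum>i=1..n. \<phi> (x i)) - m\<bar>}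
      \<le> emeasure ?P {x \<in> space ?P. real n * l \<le> (\<Sum>i=1..n. 1 * (\<phi> (x i) - m))}
       + emeasure ?P {x \<in> space ?P. real n * l \<le> (\<Sum>i=1..n. (-1) * (\<phi> (x i) - m))}"
    by (intro order_trans[OF emeasure_mono emeasure_subadditive] sets.Un)
  also have "\<dots> \<le> ennreal (exp (- (real n * t * l / 2))) + ennreal (exp (- (real n * t * l / 2)))"
    by (intro add_mono dev) auto
  also have "\<dots> = ennreal (2 * exp (- (real n * t * l / 2)))"
    by (simp add: ennreal_plus[symmetric] del: ennreal_plus)
  finally show ?thesis by (simp add: m_def)
qed

section \<open>Norms of the kernel and of its rescalings\<close>

lemma kernel_bounded_supp:
  assumes K: "smoothing_kernel K A"
  shows "bounded_supp (sup_norm UNIV K) A K"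
proof -
  have "bounded (range K)" using K by (simp add: smoothing_kernel_def)
  then have "bdd_above (range (\<lambda>t. \<bar>K t\<bar>))"
    by (auto simp: bounded_iff bdd_above_def)
  then have "\<bar>K x\<bar> \<le> sup_norm UNIV K" for x
    unfolding sup_norm_def by (rule cSUP_upper2) auto
  moreover have "K x = 0" if "A < \<bar>x\<bar>" for x
    using K that unfolding smoothing_kernel_def by (cases "x \<ge> 0") auto
  ultimately show ?thesis using K by (auto simp: bounded_supp_def smoothing_kernel_def)
qed

lemma bounded_supp_scaled:
  assumes u: "bounded_supp B R u" and h: "0 < h"
  shows "bounded_supp (B / h) (R * h) (scaled u h)"
  using bounded_suppD[OF u] h unfolding bounded_supp_def scaled_def
  by (auto simp: divide_right_mono abs_mult pos_less_divide_eq)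

lemma integral_scaled:
  fixes u :: "real \<Rightarrow> real"
  assumes "0 < h"
  shows "(LINT x|lborel. u (x / h)) = h * (LINT x|lborel. u x)"
  using lborel_integral_real_affine[of "1/h" u 0] assms by simp

lemma Lp_norm_1: "Lp_norm 1 K = (LINT x|lborel. \<bar>K x\<bar>)"
  by (simp add: Lp_norm_def integral_nonneg_AE)

lemma Lp_norm_2_square: "(Lp_norm 2 K)\<^sup>2 = (LINT x|lborel. (K x)\<^sup>2)"
proof -
  have "(\<lambda>x. \<bar>K x\<bar> powr 2) = (\<lambda>x. (K x)\<^sup>2)"
    by (auto simp: fun_eq_iff powr_numeral)
  then have "Lp_norm 2 K = (LINT x|lborel. (K x)\<^sup>2) powr (1 / 2)"
    by (simp add: Lp_norm_def)
  also have "\<dots> = sqrt (LINT x|lborel. (K x)\<^sup>2)"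
    by (simp add: powr_half_sqrt integral_nonneg_AE)
  finally show ?thesis by (simp add: integral_nonneg_AE)
qed

text \<open>Integral 1 bounds the L1 norm from below and prevents K from vanishing almost
  everywhere. Later, lower powers of ||K||_1 are absorbed into higher ones and ||K||_2 is divided
  by.\<close>

lemma kernel_norms:
  assumes K: "smoothing_kernel K A"
  shows "1 \<le> Lp_norm 1 K" and "0 < Lp_norm 2 K"
proof -
  have "(LINT x|lborel. K x) = 1" "integrable lborel K" "integrable lborel (\<lambda>x. (K x)\<^sup>2)"
    using K by (auto simp: smoothing_kernel_def)
  note * = this
  show "1 \<le> Lp_norm 1 K"
    using integral_abs_bound[of lborel K] * by (simp add: Lp_norm_1)
  have "(LINT x|lborel. (K x)\<^sup>2) \<noteq> 0"
  proof
    assume "(LINT x|lborel. (K x)\<^sup>2) = 0"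
    then have "AE x in lborel. (K x)\<^sup>2 = 0"
      using integral_nonneg_eq_0_iff_AE[OF *(3)] by simp
    then have "AE x in lborel. K x = 0" by simp
    then have "(LINT x|lborel. K x) = 0" by (simp add: integral_eq_zero_AE)
    then show False using * by simp
  qed
  then have "(Lp_norm 2 K)\<^sup>2 \<noteq> 0" unfolding Lp_norm_2_square .
  moreover have "0 \<le> Lp_norm 2 K" by (simp add: Lp_norm_def)
  ultimately show "0 < Lp_norm 2 K" by (cases "Lp_norm 2 K = 0") auto
qed

lemma scaled_norms:
  assumes "0 < h"
  shows "(LINT x|lborel. \<bar>scaled K h x\<bar>) = Lp_norm 1 K"
    and "(LINT x|lborel. (scaled K h x)\<^sup>2) = (Lp_norm 2 K)\<^sup>2 / h"
  using integral_scaled[of h "\<lambda>x. \<bar>K x\<bar>"] integral_scaled[of h "\<lambda>x. (K x)\<^sup>2"] assms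
  unfolding Lp_norm_2_square by (simp_all add: scaled_def Lp_norm_1 power_divide power2_eq_square)

section \<open>The oracle comparison and the calibration of the penalty\<close>

text \<open>Closeness of v and w is asked only where the kernel centred at x sees them; this keeps
  all bias estimates local.\<close>

lemma conv_diff_bound:
  assumes u: "bounded_supp B R u" and v: "bounded_supp B' R' v" and w: "bounded_supp B'' R'' w"
    and e: "\<And>s. \<bar>x - s\<bar> \<le> R \<Longrightarrow> \<bar>v s - w s\<bar> \<le> e"
  shows "\<bar>conv u v x - conv u w x\<bar> \<le> (LINT t|lborel. \<bar>u t\<bar>) * e"
proof -
  have i: "integrable lborel (\<lambda>s. u (x - s) * v s)" "integrable lborel (\<lambda>s. u (x - s) * w s)"
    using bounded_supp_integrable[OF bounded_supp_mult[OF bounded_supp_shift[OF u]]] v w by blast+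
  have "\<bar>conv u v x - conv u w x\<bar> = \<bar>LINT s|lborel. u (x - s) * v s - u (x - s) * w s\<bar>"
    using i by (simp add: conv_def)
  also have "\<dots> \<le> (LINT s|lborel. \<bar>u (x - s) * v s - u (x - s) * w s\<bar>)"
    by (rule integral_abs_bound)
  also have "\<dots> \<le> (LINT s|lborel. \<bar>u (x - s)\<bar> * e)"
  proof (intro integral_mono)
    show "\<bar>u (x - s) * v s - u (x - s) * w s\<bar> \<le> \<bar>u (x - s)\<bar> * e" for s
    proof (cases "\<bar>x - s\<bar> \<le> R")
      case True
      then show ?thesis
        using mult_left_mono[OF e[OF True], of "\<bar>u (x - s)\<bar>"]
        by (simp add: abs_mult[symmetric] right_diff_distrib)
    next
      case False
      then show ?thesis using bounded_suppD(3)[OF u] by simp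
    qed
  qed (use i bounded_supp_integrable[OF bounded_supp_abs[OF bounded_supp_shift[OF u]]] in auto)
  also have "\<dots> = (LINT t|lborel. \<bar>u t\<bar>) * e"
    using integral_reflect_shift[of "\<lambda>t. \<bar>u t\<bar>" x] by simp
  finally show ?thesis .
qed

lemma square_le_if_abs_le: "\<bar>x\<bar> \<le> y \<Longrightarrow> x\<^sup>2 \<le> (y::real)\<^sup>2"
  using power_mono[of "\<bar>x\<bar>" y 2] by simp

lemma sum2_sq_le: "(x + y)\<^sup>2 \<le> 2 * x\<^sup>2 + 2 * (y::real)\<^sup>2"
  using zero_le_power2[of "x - y"] by (simp add: power2_eq_square algebra_simps)

lemma sum3_sq_le: "(x + y + z)\<^sup>2 \<le> 3 * x\<^sup>2 + 3 * y\<^sup>2 + 3 * (z::real)\<^sup>2"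
proof -
  have "0 \<le> (x - y)\<^sup>2 + (y - z)\<^sup>2 + (x - z)\<^sup>2" by simp
  then show ?thesis by (simp add: power2_eq_square algebra_simps)
qed

text \<open>Here \<open>h\<close> is an arbitrary competitor, \<open>e\<close> the single and
  \<open>ee\<close> the double estimator, and \<open>m\<close>, \<open>mm\<close> their means. The
  path from e s to y passes through ee h s and e h. Its first step costs Q h + V s and, by symmetry
  of \<open>ee\<close>, its second costs Q s + V h; minimality bounds the sum by 2 (Q h + V h). Only
  the row of \<open>h\<close> in \<open>ee\<close> needs a deviation bound.\<close>

lemma Goldenshluger_Lepski_oracle:
  fixes e :: "real \<Rightarrow> real" and ee :: "real \<Rightarrow> real \<Rightarrow> real" and V :: "real \<Rightarrow> real"
  assumes H: "finite H" "h \<in> H"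
    and min: "is_arg_min (\<lambda>h. Max ((\<lambda>h'. max 0 ((ee h h' - e h')\<^sup>2 - V h')) ` H) + V h) (\<lambda>h. h \<in> H) s"
    and sym: "\<And>h h'. ee h h' = ee h' h"
    and dev: "\<And>h'. h' \<in> H \<Longrightarrow> (e h' - m h')\<^sup>2 \<le> V h' / 6"
    and dev2: "\<And>h'. h' \<in> H \<Longrightarrow> (ee h h' - mm h')\<^sup>2 \<le> V h' / 6"
    and bias: "\<And>h'. h' \<in> H \<Longrightarrow> \<bar>mm h' - m h'\<bar> \<le> \<beta>"
    and bias0: "\<bar>m h - y\<bar> \<le> \<beta>0"
  shows "(e s - y)\<^sup>2 \<le> 18 * \<beta>\<^sup>2 + 6 * \<beta>0\<^sup>2 + 7 * V h"
proof -
  define Q where "Q h = Max ((\<lambda>h'. max 0 ((ee h h' - e h')\<^sup>2 - V h')) ` H)" for h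
  have s: "s \<in> H" and le: "Q s + V s \<le> Q h + V h"
    using min H unfolding is_arg_min_linorder Q_def by auto
  have Q: "(ee k h' - e h')\<^sup>2 \<le> Q k + V h'" if "h' \<in> H" for k h'
  proof -
    have "max 0 ((ee k h' - e h')\<^sup>2 - V h') \<le> Q k"
      unfolding Q_def using that H by (intro Max_ge) auto
    then show ?thesis by simp
  qed
  \<comment> \<open>This is why the threshold is V/6: two squared deviations enter with factor 3
    each and add up to V, which Q subtracts. Only the bias remains.\<close>
  have "Q h \<le> 3 * \<beta>\<^sup>2"
    unfolding Q_def
  proof (rule Max.boundedI)
    show "finite ((\<lambda>h'. max 0 ((ee h h' - e h')\<^sup>2 - V h')) ` H)"
      "(\<lambda>h'. max 0 ((ee h h' - e h')\<^sup>2 - V h')) ` H \<noteq> {}" using H by auto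
    fix q assume "q \<in> (\<lambda>h'. max 0 ((ee h h' - e h')\<^sup>2 - V h')) ` H"
    then obtain h' where h': "h' \<in> H" and q: "q = max 0 ((ee h h' - e h')\<^sup>2 - V h')" by auto
    have "(ee h h' - e h')\<^sup>2 = ((ee h h' - mm h') + (m h' - e h') + (mm h' - m h'))\<^sup>2" by simp
    also have "\<dots> \<le> 3 * (ee h h' - mm h')\<^sup>2 + 3 * (m h' - e h')\<^sup>2 + 3 * (mm h' - m h')\<^sup>2"
      by (rule sum3_sq_le)
    finally show "q \<le> 3 * \<beta>\<^sup>2"
      using dev[OF h'] dev2[OF h'] square_le_if_abs_le[OF bias[OF h']]
      by (simp add: q power2_commute[of "m h'" "e h'"])
  qed
  moreover have "(e s - ee h s)\<^sup>2 \<le> Q h + V s" using Q[OF s, of h] by (simp add: power2_commute)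
  moreover have "(ee h s - e h)\<^sup>2 \<le> Q s + V h" using Q[OF H(2), of s] sym by simp
  moreover have "(e h - y)\<^sup>2 \<le> 2 * (e h - m h)\<^sup>2 + 2 * (m h - y)\<^sup>2"
    using sum2_sq_le[of "e h - m h" "m h - y"] by simp
  moreover have "(e s - y)\<^sup>2 \<le> 3 * (e s - ee h s)\<^sup>2 + 3 * (ee h s - e h)\<^sup>2 + 3 * (e h - y)\<^sup>2"
    using sum3_sq_le[of "e s - ee h s" "ee h s - e h" "e h - y"] by simp
  moreover have "(e h - m h)\<^sup>2 \<le> V h / 6" "(m h - y)\<^sup>2 \<le> \<beta>0\<^sup>2"
    using dev[OF H(2)] square_le_if_abs_le[OF bias0] by auto
  \<comment> \<open>The first two steps contribute 3 * 2 * (3 \<beta>^2 + V h), the third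
    contributes V h + 6 \<beta>0^2.\<close>
  ultimately show ?thesis using le by linarith
qed

text \<open>\<open>l\<close> is the admitted deviation and \<open>t\<close> the Chernoff parameter, chosen such that
  \<open>exp (- n t l / 2) = n ^ (-12)\<close>; the lower bound on \<open>\<kappa>\<close> is what makes both of its constraints hold.\<close>

lemma Bernstein_calibration:
  fixes n h \<delta> G \<kappa> :: real
  assumes pos: "1 < n" "0 < h" "0 < \<delta>" "0 < G" "1 \<le> K1" "0 < K2" "0 < gm"
    and gm: "gm \<le> 2 * G" and h: "1 / h \<le> gm * n / (ln n)^3"
    and \<kappa>: "48^3 * (1 + 2 * G)\<^sup>2 / \<delta>\<^sup>2 \<le> \<kappa>" and Kinf: "0 \<le> Kinf" "Kinf \<le> K2 * ln n"
    and W: "0 \<le> W" "W \<le> 2 / \<delta> * (1 + 1 / gm)"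
    and V: "V = \<kappa> * K1\<^sup>2 * K2\<^sup>2 * G / (gm\<^sup>2 * n * h) * ln n"
    and l: "l = sqrt (V / 6)" and t: "t = 24 * ln n / (n * l)"
  shows "0 \<le> t" "2 * t * (W * (K1 * Kinf / h)) \<le> 1"
    and "t * (W\<^sup>2 * G * (K1\<^sup>2 * K2\<^sup>2 / h)) \<le> l / 2" and "n * t * l / 2 = 12 * ln n"
proof -
  define q where "q = 1 + 2 * G"
  have q: "0 < q" using pos by (simp add: q_def)
  have ln: "0 < ln n" using pos by simp
  have k: "0 < \<kappa>"
    by (rule less_le_trans[OF _ \<kappa>]) (use pos in simp)
  have V0: "0 < V" unfolding V using pos k ln by simp
  then have l0: "0 < l" unfolding l by simp
  have l2: "l\<^sup>2 = V / 6" using V0 by (simp add: l)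
  show "0 \<le> t" using l0 ln pos by (simp add: t)
  show "n * t * l / 2 = 12 * ln n" using l0 pos by (simp add: t)
  have "W \<le> 2 * q / (\<delta> * gm)"
  proof -
    \<comment> \<open>Here gm <= 2G absorbs the constant 1 of the weight bound into q/gm, so that W
      scales like 1/gm, as the square root of V does.\<close>
    have "1 + 1 / gm \<le> q / gm" using gm pos by (simp add: q_def field_simps)
    then have "2 / \<delta> * (1 + 1 / gm) \<le> 2 / \<delta> * (q / gm)"
      using pos by (intro mult_left_mono) auto
    then show ?thesis using W by simp
  qed
  then have W2: "W\<^sup>2 \<le> (2 * q / (\<delta> * gm))\<^sup>2" using W by (intro power_mono)
  have k1: "110592 * q\<^sup>2 \<le> \<kappa> * \<delta>\<^sup>2" using \<kappa> pos by (simp add: q_def field_simps)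
  show "t * (W\<^sup>2 * G * (K1\<^sup>2 * K2\<^sup>2 / h)) \<le> l / 2"
  proof -
    have "48 * ln n * (W\<^sup>2 * (G * (K1\<^sup>2 * K2\<^sup>2 / h)))
        \<le> 48 * ln n * ((2 * q / (\<delta> * gm))\<^sup>2 * (G * (K1\<^sup>2 * K2\<^sup>2 / h)))"
      using W2 pos ln by (intro mult_left_mono mult_right_mono) auto
    also have "\<dots> = 192 * q\<^sup>2 * (G * K1\<^sup>2 * K2\<^sup>2 * ln n / (\<delta>\<^sup>2 * gm\<^sup>2 * h))"
      by (simp add: power_mult_distrib power_divide)
    also have "\<dots> \<le> \<kappa> * \<delta>\<^sup>2 / 6 * (G * K1\<^sup>2 * K2\<^sup>2 * ln n / (\<delta>\<^sup>2 * gm\<^sup>2 * h))"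
    proof (rule mult_right_mono)
      show "192 * q\<^sup>2 \<le> \<kappa> * \<delta>\<^sup>2 / 6" using k1 zero_le_power2[of q] by linarith
    qed (use pos ln in simp)
    also have "\<dots> = n * (V / 6)" using pos by (simp add: V field_simps)
    finally have "48 * ln n * (W\<^sup>2 * G * (K1\<^sup>2 * K2\<^sup>2 / h)) \<le> n * l\<^sup>2"
      by (simp add: l2 mult.assoc)
    then show ?thesis using l0 pos by (simp add: t field_simps power2_eq_square)
  qed
  show "2 * t * (W * (K1 * Kinf / h)) \<le> 1"
  proof -
    have "(48 * ln n * (W * (K1 * Kinf / h)))\<^sup>2 = 48\<^sup>2 * (ln n)\<^sup>2 * (W\<^sup>2 * (K1 * Kinf / h)\<^sup>2)"
      by (simp add: power_mult_distrib power_divide)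
    also have "\<dots> \<le> 48\<^sup>2 * (ln n)\<^sup>2 * ((2 * q / (\<delta> * gm))\<^sup>2 * (K1 * (K2 * ln n) / h)\<^sup>2)"
      using W2 Kinf pos by (intro mult_left_mono mult_mono power_mono[of "K1 * Kinf / h"] divide_right_mono) auto
    \<comment> \<open>Of the four logarithms, three are paired with one factor 1/h for the bandwidth
      condition; the remaining ln n / h is the one present in V. This accounts for the cube of the
      logarithm in A5.\<close>
    also have "\<dots> = (48\<^sup>2 * 4 * K1\<^sup>2 * K2\<^sup>2 * q\<^sup>2 * ln n / (\<delta>\<^sup>2 * gm\<^sup>2 * h)) * ((ln n)^3 * (1 / h))"
      by (simp add: power_mult_distrib power_divide power2_eq_square power3_eq_cube mult_ac)
    also have "\<dots> \<le> (48\<^sup>2 * 4 * K1\<^sup>2 * K2\<^sup>2 * q\<^sup>2 * ln n / (\<delta>\<^sup>2 * gm\<^sup>2 * h)) * (2 * G * n)"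
    proof (rule mult_left_mono)
      have "(ln n)^3 * (1 / h) \<le> gm * n" using h ln by (simp add: field_simps)
      also have "\<dots> \<le> 2 * G * n" using gm pos by (intro mult_right_mono) auto
      finally show "(ln n)^3 * (1 / h) \<le> 2 * G * n" .
    qed (use pos ln q in simp)
    \<comment> \<open>Origin of the threshold on \<kappa>: 110592 = 48^3 = 48^2 * 4 * 2 * 6, where
      48 = 2 * 24 comes from 2 t, the 4 from the squared constant in W, the 2 from gm <= 2G and the
      6 from V/6.\<close>
    also have "\<dots> = (110592 * q\<^sup>2) * (K1\<^sup>2 * K2\<^sup>2 * G * n * ln n / (6 * \<delta>\<^sup>2 * gm\<^sup>2 * h))"
      using pos by (simp add: field_simps power2_eq_square)
    also have "\<dots> \<le> (\<kappa> * \<delta>\<^sup>2) * (K1\<^sup>2 * K2\<^sup>2 * G * n * ln n / (6 * \<delta>\<^sup>2 * gm\<^sup>2 * h))"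
      using k1 pos ln by (intro mult_right_mono) auto
    also have "\<dots> = (n * l)\<^sup>2"
      unfolding power_mult_distrib l2 V using pos by (simp add: field_simps power2_eq_square)
    finally have "48 * ln n * (W * (K1 * Kinf / h)) \<le> n * l"
      using pos l0 by (elim power2_le_imp_le) simp
    then show ?thesis using l0 pos by (simp add: t field_simps)
  qed
qed

section \<open>Bias and variance for fixed preliminary estimates\<close>

locale mixture_model =
  fixes f :: "real \<Rightarrow> real" and \<theta> \<delta> :: real and K :: "real \<Rightarrow> real" and A a x0 :: real
  assumes dens: "unit_density f" and \<delta>: "0 < \<delta>" "\<delta> < 1" and \<theta>: "\<delta> \<le> \<theta>" "\<theta> \<le> 1 - \<delta>"
    and K: "smoothing_kernel K A" and a: "1 < a" and x0: "x0 \<in> {0..1}"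
    and A1: "assm_A1 f (nbhd A a x0)"
begin

abbreviation "g \<equiv> mixture \<theta> f"
abbreviation "J \<equiv> nbhd A a x0"
abbreviation "I \<equiv> nbhd01 A a x0"
abbreviation "G \<equiv> sup_norm I g"
abbreviation "\<gamma> \<equiv> inf_abs I g"
abbreviation "F \<equiv> sup_norm J f"
abbreviation "K1 \<equiv> Lp_norm 1 K"
abbreviation "K2 \<equiv> Lp_norm 2 K"
abbreviation "Kinf \<equiv> sup_norm UNIV K"
abbreviation "bias h \<equiv> sup_norm J (\<lambda>t. conv (scaled K h) f t - f t)"
abbreviation "M \<equiv> obs_law \<theta> f"

lemma A_pos: "0 < A" using K by (simp add: smoothing_kernel_def)

lemma f_props: "f \<in> borel_measurable borel" "0 \<le> f x" "x \<notin> {0..1} \<Longrightarrow> f x = 0"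
  "integrable lborel f" "(LINT x|lborel. f x) = 1"
proof -
  have f: "f \<in> borel_measurable borel" "\<forall>x. 0 \<le> f x" "\<forall>x. x \<notin> {0..1} \<longrightarrow> f x = 0"
    "(\<integral>\<^sup>+x. ennreal (f x) \<partial>lborel) = 1"
    using dens by (auto simp: unit_density_def)
  show "f \<in> borel_measurable borel" "0 \<le> f x" "x \<notin> {0..1} \<Longrightarrow> f x = 0" using f by auto
  show "integrable lborel f"
    using f by (intro integrableI_nonneg) auto
  show "(LINT x|lborel. f x) = 1"
    using f by (subst integral_eq_nn_integral) auto
qed

lemma f_measurable [measurable]: "f \<in> borel_measurable borel" by (rule f_props)

lemma g_measurable [measurable]: "g \<in> borel_measurable borel"
  unfolding mixture_def by measurable

lemma g_nonneg: "0 \<le> g x"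
  using \<theta> \<delta> f_props(2)[of x] by (simp add: mixture_def)

lemma sets_M [simp, measurable_cong]: "sets M = sets borel"
  by (simp add: obs_law_def)

lemma space_M [simp]: "space M = UNIV"
  by (simp add: obs_law_def)

lemma prob_space_M: "prob_space M"
proof
  have "(\<integral>\<^sup>+x. ennreal (g x) \<partial>lborel)
      = (\<integral>\<^sup>+x. ennreal (\<theta> * indicator {0..1} x + (1 - \<theta>) * f x) \<partial>lborel)"
    using f_props(3) by (intro nn_integral_cong) (auto simp: mixture_def indicator_def)
  also have "\<dots> = ennreal (LINT x|lborel. \<theta> * indicator {0..1} x + (1 - \<theta>) * f x)"
    using f_props \<theta> \<delta> by (intro nn_integral_eq_integral) (auto intro!: AE_I2 add_nonneg_nonneg)
  also have "(LINT x|lborel. \<theta> * indicator {0..1} x + (1 - \<theta>) * f x) = 1"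
    using f_props by simp
  finally show "emeasure M (space M) = 1"
    by (simp add: obs_law_def emeasure_density)
qed

lemma AE_M_unit: "AE x in M. x \<in> {0..1}"
  unfolding obs_law_def by (subst AE_density) (auto simp: mixture_def)

lemma x0_in: "x0 \<in> I" "x0 \<in> J"
  using x0 A_pos a by (auto simp: nbhd01_def nbhd_def)

lemma I_subset: "I \<subseteq> J" "I \<subseteq> {0..1}"
  by (auto simp: nbhd01_def)

lemma f_le_F: "t \<in> J \<Longrightarrow> f t \<le> F"
  using A1 f_props(2)[of t] unfolding assm_A1_def sup_norm_def
  by (intro cSUP_upper2[of _ _ t]) auto

lemma F_nonneg: "0 \<le> F" using f_le_F[OF x0_in(2)] f_props(2)[of x0] by simp

lemma g_bdd: "bdd_above ((\<lambda>t. \<bar>g t\<bar>) ` I)"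
proof (rule bdd_aboveI2[of _ _ "1 + F"])
  fix t assume t: "t \<in> I"
  have "(1 - \<theta>) * f t \<le> 1 * f t" using \<theta> \<delta> f_props(2) by (intro mult_right_mono) auto
  then show "\<bar>g t\<bar> \<le> 1 + F"
    using g_nonneg[of t] f_le_F[of t] t I_subset \<theta> \<delta> by (auto simp: mixture_def)
qed

lemma g_le_G: "t \<in> I \<Longrightarrow> g t \<le> G"
  using g_bdd g_nonneg[of t] unfolding sup_norm_def by (intro cSUP_upper2[of _ _ t]) auto

lemma \<gamma>_le: "t \<in> I \<Longrightarrow> \<gamma> \<le> g t"
  using g_nonneg[of t] unfolding inf_abs_def by (intro cINF_lower2[where x = t]) (auto intro!: bdd_belowI2[of _ 0])

lemma \<gamma>_pos: "0 < \<gamma>"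
proof -
  have "\<theta> \<le> \<gamma>"
    unfolding inf_abs_def
  proof (rule cINF_greatest)
    show "I \<noteq> {}" using x0_in by auto
    fix t assume "t \<in> I"
    then show "\<theta> \<le> \<bar>g t\<bar>"
      using I_subset f_props(2)[of t] \<theta> \<delta> by (auto simp: mixture_def)
  qed
  then show ?thesis using \<theta> \<delta> by simp
qed

lemma \<gamma>_le_G: "\<gamma> \<le> G"
  using \<gamma>_le[OF x0_in(1)] g_le_G[OF x0_in(1)] by simp

lemma G_pos: "0 < G" using \<gamma>_pos \<gamma>_le_G by simp

lemmas K1_ge = kernel_norms(1)[OF K]
lemmas K2_pos = kernel_norms(2)[OF K]

lemma Kinf_nonneg: "0 \<le> Kinf"
  using bounded_suppD(4)[OF kernel_bounded_supp[OF K]] .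

text \<open>Away from x0 the density may be unbounded. The cut-off is bounded and still agrees with
  f on all of \<open>J\<close>, because f vanishes outside [0,1].\<close>

definition f_loc :: "real \<Rightarrow> real" where "f_loc t = indicator I t * f t"

lemma I_sets [measurable]: "I \<in> sets borel"
  by (simp add: nbhd01_def nbhd_def)

lemma I_abs_le: "t \<in> I \<Longrightarrow> \<bar>t\<bar> \<le> 1"
  using I_subset by auto

lemma f_loc_bounded_supp: "bounded_supp F 1 f_loc"
  unfolding bounded_supp_def f_loc_def using f_le_F f_props(2) F_nonneg I_subset I_abs_le
  by (fastforce simp: indicator_def)

lemma f_loc_eq: "t \<in> J \<Longrightarrow> f_loc t = f t"
  using f_props(3)[of t] by (auto simp: f_loc_def indicator_def nbhd01_def)

end

section \<open>Smoothing bias near the estimation point\<close>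

locale bandwidth = mixture_model +
  fixes h :: real
  assumes h: "0 < h" "a \<le> 1 / h"
begin

lemma Kh: "bounded_supp (Kinf / h) (A * h) (scaled K h)"
  using bounded_supp_scaled[OF kernel_bounded_supp[OF K] h(1)] .

text \<open>One kernel reaches at most half the radius of \<open>J\<close>, so two kernels in
  succession stay inside \<open>J\<close>.\<close>

lemma Ah: "A * h \<le> A / a"
  using h a A_pos by (simp add: field_simps)

text \<open>It makes the supremum in \<open>bias\<close> finite, so that this real-valued supremum
  really dominates every single value. Globally only the L1 norm of f is available, hence the sup
  goes to the kernel.\<close>

lemma conv_f_le: "\<bar>conv (scaled K h) f t\<bar> \<le> Kinf / h"
proof -
  have "\<bar>conv (scaled K h) f t\<bar> \<le> (LINT s|lborel. \<bar>scaled K h (t - s) * f s\<bar>)"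
    unfolding conv_def by (rule integral_abs_bound)
  also have "\<dots> \<le> (LINT s|lborel. Kinf / h * f s)"
  proof (rule integral_mono')
    show "integrable lborel (\<lambda>s. Kinf / h * f s)" using f_props by simp
    show "\<bar>scaled K h (t - s) * f s\<bar> \<le> Kinf / h * f s" for s
      using mult_right_mono[OF bounded_suppD(2)[OF Kh, of "t - s"] f_props(2)[of s]] f_props(2)[of s]
      by (simp add: abs_mult)
    show "0 \<le> Kinf / h * f s" for s using Kinf_nonneg f_props(2) h by simp
  qed
  finally show ?thesis using f_props by simp
qed

lemma bias_ge: "t \<in> J \<Longrightarrow> \<bar>conv (scaled K h) f t - f t\<bar> \<le> bias h"
  unfolding sup_norm_def
proof (rule cSUP_upper)
  show "bdd_above ((\<lambda>t. \<bar>conv (scaled K h) f t - f t\<bar>) ` J)"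
  proof (rule bdd_aboveI2[of _ _ "Kinf / h + F"])
    fix t assume "t \<in> J"
    then show "\<bar>conv (scaled K h) f t - f t\<bar> \<le> Kinf / h + F"
      using conv_f_le[of t] f_le_F[of t] f_props(2)[of t] by linarith
  qed
qed

text \<open>From a point within A/a of x0 the kernel sees only \<open>J\<close>, where f and its
  cut-off coincide.\<close>

lemma conv_f_loc:
  assumes "\<bar>x0 - t\<bar> \<le> A / a"
  shows "conv (scaled K h) f_loc t = conv (scaled K h) f t"
proof -
  have "scaled K h (t - s) * f_loc s = scaled K h (t - s) * f s" for s
  proof (cases "\<bar>t - s\<bar> \<le> A * h")
    case True
    then have "s \<in> J"
      using assms Ah unfolding nbhd_def times_divide_eq_right[symmetric] by (auto simp: abs_le_iff)
    then show ?thesis using f_loc_eq by simp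
  next
    case False
    then show ?thesis using bounded_suppD(3)[OF Kh] by simp
  qed
  then show ?thesis unfolding conv_def by (rule Bochner_Integration.integral_cong[OF refl])
qed

lemma J_near: "\<bar>x0 - t\<bar> \<le> A / a \<Longrightarrow> t \<in> J"
  using divide_pos_pos[OF A_pos, of a] a unfolding nbhd_def times_divide_eq_right[symmetric]
  by (auto simp: abs_le_iff)

lemma bias_point:
  assumes v: "bounded_supp B R v" and e: "\<And>s. \<bar>v s - f_loc s\<bar> \<le> \<epsilon>" and t: "\<bar>x0 - t\<bar> \<le> A / a"
  shows "\<bar>conv (scaled K h) v t - f t\<bar> \<le> bias h + K1 * \<epsilon>"
proof -
  have "\<bar>conv (scaled K h) v t - conv (scaled K h) f_loc t\<bar> \<le> K1 * \<epsilon>"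
    using conv_diff_bound[OF Kh v f_loc_bounded_supp e, of t] scaled_norms(1)[OF h(1)] by simp
  then show ?thesis
    using bias_ge[OF J_near[OF t]] conv_f_loc[OF t] by linarith
qed

lemma bias_point_x0:
  assumes v: "bounded_supp B R v" and e: "\<And>s. \<bar>v s - f_loc s\<bar> \<le> \<epsilon>"
  shows "\<bar>conv (scaled K h) v x0 - f x0\<bar> \<le> bias h + K1 * \<epsilon>"
  using bias_point[OF v e] A_pos a by simp

text \<open>Exchanging the smoothings turns the difference into K_h' acting on K_h v - v. The inner
  error is the bias of f plus K1 \<epsilon> for replacing v by f_loc under the kernel plus
  \<epsilon> for replacing it outside. The bound does not depend on h'.\<close>

lemma bias_double:
  assumes h': "0 < h'" "a \<le> 1 / h'"
    and v: "bounded_supp B R v" and e: "\<And>s. \<bar>v s - f_loc s\<bar> \<le> \<epsilon>"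
  shows "\<bar>conv (conv (scaled K h) (scaled K h')) v x0 - conv (scaled K h') v x0\<bar>
    \<le> K1 * (bias h + (K1 + 1) * \<epsilon>)"
proof -
  interpret h': bandwidth f \<theta> \<delta> K A a x0 h' by unfold_locales (rule h')+
  have "\<bar>conv (scaled K h') (conv (scaled K h) v) x0 - conv (scaled K h') v x0\<bar>
      \<le> (LINT t|lborel. \<bar>scaled K h' t\<bar>) * (bias h + (K1 + 1) * \<epsilon>)"
  proof (rule conv_diff_bound[OF h'.Kh bounded_supp_conv[OF Kh v] v])
    fix s assume "\<bar>x0 - s\<bar> \<le> A * h'"
    then have s: "\<bar>x0 - s\<bar> \<le> A / a" using h'.Ah by simp
    show "\<bar>conv (scaled K h) v s - v s\<bar> \<le> bias h + (K1 + 1) * \<epsilon>"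
      using bias_point[OF v e s] e[of s] f_loc_eq[OF J_near[OF s]] by (simp add: algebra_simps)
  qed
  then show ?thesis
    using conv_conv_eq[OF Kh h'.Kh v] scaled_norms(1)[OF h'(1)] by simp
qed

end

text \<open>The density-like function that the weighted estimator targets when \<tau> and gh are
  frozen. At the true values \<tau> = \<theta> and gh = g it is f on \<open>I\<close>.\<close>

definition plug_in :: "real set \<Rightarrow> (real \<Rightarrow> real) \<Rightarrow> real \<Rightarrow> (real \<Rightarrow> real) \<Rightarrow> real \<Rightarrow> real" where
  "plug_in I g \<tau> gh t = indicator I t * weight \<tau> (gh t) * g t"

text \<open>The indicator drops observations in the neighbourhood but outside \<open>[0,1]\<close>, where the estimator of
  \<open>g\<close> is not controlled; almost surely there are none.\<close>

definition plug_summand ::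
  "real set \<Rightarrow> real \<Rightarrow> (real \<Rightarrow> real) \<Rightarrow> real \<Rightarrow> (real \<Rightarrow> real) \<Rightarrow> real \<Rightarrow> real" where
  "plug_summand I \<tau> gh x0 L x = indicator I x * weight \<tau> (gh x) * L (x0 - x)"

locale plugin = mixture_model +
  fixes \<tau> :: real and gh :: "real \<Rightarrow> real"
  assumes \<tau>: "\<delta> / 2 \<le> \<tau>" "\<tau> \<le> 1 - \<delta> / 2" and gh [measurable]: "gh \<in> borel_measurable borel"
    and gm_pos: "0 < inf_abs I gh"
begin

abbreviation "gm \<equiv> inf_abs I gh"

definition W :: real where "W = 2 / \<delta> * (1 + 1 / gm)"

lemma W_nonneg: "0 \<le> W" using \<delta> gm_pos by (simp add: W_def)

lemma gm_le: "t \<in> I \<Longrightarrow> gm \<le> \<bar>gh t\<bar>"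
  unfolding inf_abs_def by (intro cINF_lower2[where x = t]) (auto intro!: bdd_belowI2[of _ 0])

lemma weight_le:
  assumes "t \<in> I"
  shows "\<bar>weight \<tau> (gh t)\<bar> \<le> W"
proof -
  have "1 / (1 - \<tau>) \<le> 2 / \<delta>" using \<tau> \<delta> by (simp add: field_simps)
  moreover have "\<bar>1 - \<tau> / gh t\<bar> \<le> 1 + 1 / gm"
  proof -
    have "\<bar>1 - \<tau> / gh t\<bar> \<le> 1 + \<bar>\<tau>\<bar> / \<bar>gh t\<bar>" using abs_triangle_ineq4[of 1 "\<tau> / gh t"] by simp
    also have "\<dots> \<le> 1 + 1 / gm"
      using gm_le[OF assms] gm_pos \<tau> \<delta> by (intro add_left_mono frac_le) auto
    finally show ?thesis .
  qed
  ultimately have "1 / (1 - \<tau>) * \<bar>1 - \<tau> / gh t\<bar> \<le> 2 / \<delta> * (1 + 1 / gm)"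
    using \<delta> \<tau> by (intro mult_mono) auto
  then show ?thesis using \<tau> \<delta> by (simp add: weight_def W_def abs_mult)
qed

abbreviation "f_plug \<equiv> plug_in I g \<tau> gh"
abbreviation "summand \<equiv> plug_summand I \<tau> gh x0"

lemma weight_measurable [measurable]: "(\<lambda>x. weight \<tau> (gh x)) \<in> borel_measurable borel"
  unfolding weight_def by measurable

lemma f_plug_bounded_supp: "bounded_supp (W * G) 1 f_plug"
proof -
  have "\<bar>f_plug t\<bar> \<le> W * G" for t
    using mult_mono[OF weight_le g_le_G W_nonneg g_nonneg, of t t] W_nonneg G_pos g_nonneg[of t]
    by (cases "t \<in> I") (auto simp: plug_in_def abs_mult)
  moreover have "f_plug t = 0" if "1 < \<bar>t\<bar>" for t
    using I_abs_le[of t] that by (auto simp: plug_in_def indicator_def)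
  moreover have "f_plug \<in> borel_measurable borel"
    unfolding plug_in_def by measurable
  ultimately show ?thesis by (simp add: bounded_supp_def)
qed

lemma summand_measurable:
  assumes [measurable]: "L \<in> borel_measurable borel"
  shows "summand L \<in> borel_measurable M"
  unfolding plug_summand_def by measurable

lemma integral_M:
  assumes [measurable]: "u \<in> borel_measurable borel"
  shows "(LINT x|M. u x) = (LINT x|lborel. g x * u x)"
  unfolding obs_law_def using g_nonneg by (subst integral_density) auto

lemma summand_mean:
  assumes [measurable]: "L \<in> borel_measurable borel"
  shows "(LINT x|M. summand L x) = conv L f_plug x0"
proof -
  have "summand L \<in> borel_measurable borel" unfolding plug_summand_def by measurable
  then show ?thesis
    unfolding conv_def
    by (subst integral_M) (auto intro!: Bochner_Integration.integral_cong simp: plug_summand_def plug_in_def)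
qed

lemma summand_bound:
  assumes "bounded_supp B R L"
  shows "\<bar>summand L x\<bar> \<le> W * B"
  using mult_mono[OF weight_le bounded_suppD(2)[OF assms, of "x0 - x"] W_nonneg, of x] W_nonneg bounded_suppD(4)[OF assms]
  by (cases "x \<in> I") (auto simp: plug_summand_def abs_mult)

text \<open>Bounding g by G on \<open>I\<close> leaves the squared L2 norm of the kernel, which is
  of order 1/h; the squared sup would be of order 1/h^2.\<close>

lemma summand_second_moment:
  assumes L: "bounded_supp B R L"
  shows "(LINT x|M. (summand L x)\<^sup>2) \<le> W\<^sup>2 * G * (LINT x|lborel. (L x)\<^sup>2)"
proof -
  have [measurable]: "L \<in> borel_measurable borel" using bounded_suppD[OF L] by simp
  have "(\<lambda>x. (summand L x)\<^sup>2) \<in> borel_measurable borel" unfolding plug_summand_def by measurable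
  then have "(LINT x|M. (summand L x)\<^sup>2) = (LINT x|lborel. g x * (summand L x)\<^sup>2)"
    by (rule integral_M)
  also have "\<dots> \<le> (LINT x|lborel. W\<^sup>2 * G * (L (x0 - x))\<^sup>2)"
  proof (rule integral_mono')
    show "integrable lborel (\<lambda>x. W\<^sup>2 * G * (L (x0 - x))\<^sup>2)"
      using bounded_supp_integrable[OF bounded_supp_shift[OF bounded_supp_square[OF L]]] by simp
    show "0 \<le> W\<^sup>2 * G * (L (x0 - x))\<^sup>2" for x using G_pos by simp
    show "g x * (summand L x)\<^sup>2 \<le> W\<^sup>2 * G * (L (x0 - x))\<^sup>2" for x
    proof (cases "x \<in> I")
      case True
      have "g x * ((weight \<tau> (gh x))\<^sup>2 * (L (x0 - x))\<^sup>2) \<le> G * (W\<^sup>2 * (L (x0 - x))\<^sup>2)"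
        using g_le_G[OF True] square_le_if_abs_le[OF weight_le[OF True]] G_pos
        by (intro mult_mono mult_right_mono) auto
      then show ?thesis using True by (simp add: plug_summand_def power_mult_distrib mult_ac)
    next
      case False
      then show ?thesis using G_pos by (simp add: plug_summand_def)
    qed
  qed
  also have "\<dots> = W\<^sup>2 * G * (LINT x|lborel. (L x)\<^sup>2)"
    using integral_reflect_shift[of "\<lambda>x. (L x)\<^sup>2" x0] by simp
  finally show ?thesis .
qed

text \<open>A point of [0,1] outside \<open>I\<close> is further than 2A/a from x0, where L
  vanishes, so the indicator in \<open>summand\<close> changes nothing.\<close>

lemma weighted_est_eq:
  assumes X: "\<And>i. i \<in> {1..n} \<Longrightarrow> X i \<in> {0..1}" and L: "\<And>x. 2 * A / a < \<bar>x\<bar> \<Longrightarrow> L x = 0"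
  shows "weighted_est n \<tau> gh X x0 L = 1 / real n * (\<Sum>i=1..n. summand L (X i))"
proof -
  have "weight \<tau> (gh x) * L (x0 - x) = summand L x" if "x \<in> {0..1}" for x
  proof (cases "x \<in> I")
    case False
    then have "2 * A / a < \<bar>x0 - x\<bar>"
      using that by (auto simp: nbhd01_def nbhd_def)
    then show ?thesis using L False by (simp add: plug_summand_def)
  qed (simp add: plug_summand_def)
  then show ?thesis unfolding weighted_est_def using X by simp
qed

lemma f_plug_error:
  assumes s: "\<And>t. t \<in> I \<Longrightarrow> \<bar>gh t - g t\<bar> \<le> s"
  shows "\<bar>f_plug t - f_loc t\<bar> \<le> 2 / \<delta> * (s / gm) + 2 / \<delta>\<^sup>2 * (G + 1) * \<bar>\<tau> - \<theta>\<bar>"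
proof (cases "t \<in> I")
  case True
  have y: "gh t \<noteq> 0" using gm_le[OF True] gm_pos by auto
  have t1: "1 - \<tau> \<noteq> 0" "1 - \<theta> \<noteq> 0" using \<tau> \<theta> \<delta> by auto
  have f: "f t = (g t - \<theta>) / (1 - \<theta>)"
    using True I_subset t1 by (auto simp: mixture_def)
  \<comment> \<open>Both terms arise by passing through (g t - \<tau>) / (1 - \<tau>): first gh is
    replaced by g, then \<tau> by \<theta>. The factor g t - 1 is the source of (G + 1)^2 in the
    final constant.\<close>
  have "f_plug t - f_loc t = \<tau> / (1 - \<tau>) * ((gh t - g t) / gh t)
      + (g t - 1) * (\<tau> - \<theta>) / ((1 - \<tau>) * (1 - \<theta>))"
    using True y t1 by (simp add: plug_in_def f_loc_def f weight_def divide_simps) (simp add: algebra_simps)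
  also have "\<bar>\<dots>\<bar> \<le> \<bar>\<tau> / (1 - \<tau>)\<bar> * (\<bar>gh t - g t\<bar> / \<bar>gh t\<bar>)
      + \<bar>g t - 1\<bar> * \<bar>\<tau> - \<theta>\<bar> * (1 / ((1 - \<tau>) * (1 - \<theta>)))"
    using \<tau> \<theta> \<delta> by (intro order_trans[OF abs_triangle_ineq]) (simp add: abs_mult)
  also have "\<dots> \<le> 2 / \<delta> * (s / gm) + (G + 1) * \<bar>\<tau> - \<theta>\<bar> * (2 / \<delta>\<^sup>2)"
  proof (intro add_mono mult_mono)
    show "\<bar>\<tau> / (1 - \<tau>)\<bar> \<le> 2 / \<delta>"
    proof -
      have "\<tau> / (1 - \<tau>) \<le> 1 / (\<delta> / 2)" using \<tau> \<delta> by (intro frac_le) auto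
      then show ?thesis using \<tau> \<delta> by simp
    qed
    show "\<bar>gh t - g t\<bar> / \<bar>gh t\<bar> \<le> s / gm"
      using s[OF True] gm_le[OF True] gm_pos by (intro frac_le) (auto intro: order_trans[OF abs_ge_zero])
    show "\<bar>g t - 1\<bar> \<le> G + 1" using g_le_G[OF True] g_nonneg[of t] by simp
    have "\<delta> / 2 * \<delta> \<le> (1 - \<tau>) * (1 - \<theta>)" using \<tau> \<theta> \<delta> by (intro mult_mono) auto
    then have "1 / ((1 - \<tau>) * (1 - \<theta>)) \<le> 1 / (\<delta> / 2 * \<delta>)"
      using \<delta> by (intro frac_le) auto
    then show "1 / ((1 - \<tau>) * (1 - \<theta>)) \<le> 2 / \<delta>\<^sup>2" by (simp add: power2_eq_square)
  qed (use \<tau> \<theta> \<delta> G_pos in auto)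
  finally show ?thesis by (simp add: mult_ac)
next
  case False
  have "0 \<le> s" using s[OF x0_in(1)] by (rule order_trans[OF abs_ge_zero])
  then show ?thesis using False gm_pos \<delta> G_pos by (simp add: plug_in_def f_loc_def)
qed

end

lemma bounded_supp_mono:
  assumes "bounded_supp B R u" "B \<le> B'" shows "bounded_supp B' R u"
  using assms unfolding bounded_supp_def by (auto intro: order_trans)

text \<open>The single and the double kernel satisfy identical bounds governed by h' alone:
  smoothing by K_h costs only powers of ||K||_1, by Young's inequality for the L2 norm. Hence the
  same penalty at h' controls both.\<close>

lemma (in bandwidth) admissible_kernels:
  assumes h': "0 < h'" "a \<le> 1 / h'"
  shows "bounded_supp (K1 * Kinf / h') (A * h') (scaled K h')"
    and "(LINT x|lborel. (scaled K h' x)\<^sup>2) \<le> K1\<^sup>2 * K2\<^sup>2 / h'"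
    and "bounded_supp (K1 * Kinf / h') (A * h' + A * h) (conv (scaled K h) (scaled K h'))"
    and "(LINT x|lborel. (conv (scaled K h) (scaled K h') x)\<^sup>2) \<le> K1\<^sup>2 * K2\<^sup>2 / h'"
    and "2 * A / a < \<bar>x\<bar> \<Longrightarrow> scaled K h' x = 0"
    and "2 * A / a < \<bar>x\<bar> \<Longrightarrow> conv (scaled K h) (scaled K h') x = 0"
proof -
  interpret h': bandwidth f \<theta> \<delta> K A a x0 h' by unfold_locales (rule h')+
  have "1 * (Kinf / h') \<le> K1 * (Kinf / h')"
    using K1_ge Kinf_nonneg h' by (intro mult_right_mono) auto
  then show "bounded_supp (K1 * Kinf / h') (A * h') (scaled K h')"
    using bounded_supp_mono[OF h'.Kh] by simp
  have "1 * (K2\<^sup>2 / h') \<le> K1\<^sup>2 * (K2\<^sup>2 / h')"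
    using one_le_power[OF K1_ge, of 2] h' by (intro mult_right_mono) auto
  then show "(LINT x|lborel. (scaled K h' x)\<^sup>2) \<le> K1\<^sup>2 * K2\<^sup>2 / h'"
    using scaled_norms(2)[OF h'(1)] by simp
  show c: "bounded_supp (K1 * Kinf / h') (A * h' + A * h) (conv (scaled K h) (scaled K h'))"
    using bounded_supp_conv[OF h'.Kh Kh] scaled_norms(1)[OF h(1)]
    by (simp add: conv_commute[of "scaled K h"] mult.commute)
  show "(LINT x|lborel. (conv (scaled K h) (scaled K h') x)\<^sup>2) \<le> K1\<^sup>2 * K2\<^sup>2 / h'"
    using Young_conv_square[OF Kh h'.Kh] scaled_norms[OF h(1)] scaled_norms[OF h'(1)] by simp
  have "0 < A / a" using A_pos a by simp
  then have "A * h' \<le> 2 * A / a" "A * h' + A * h \<le> 2 * A / a"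
    using Ah h'.Ah unfolding times_divide_eq_right[symmetric] by auto
  then show "2 * A / a < \<bar>x\<bar> \<Longrightarrow> scaled K h' x = 0"
    "2 * A / a < \<bar>x\<bar> \<Longrightarrow> conv (scaled K h) (scaled K h') x = 0"
    using bounded_suppD(3)[OF h'.Kh, of x] bounded_suppD(3)[OF c, of x] by simp_all
qed

section \<open>Deviations, crude bound and oracle bound for frozen preliminary estimates\<close>

context plugin
begin

lemma deviation_prob:
  assumes n: "1 < n" and h: "0 < h" "1 / h \<le> gm * real n / (ln (real n))^3"
    and L: "bounded_supp (K1 * Kinf / h) R L" "(LINT x|lborel. (L x)\<^sup>2) \<le> K1\<^sup>2 * K2\<^sup>2 / h"
    and \<kappa>: "48^3 * (1 + 2 * G)\<^sup>2 / \<delta>\<^sup>2 \<le> \<kappa>" and Kinf: "Kinf \<le> K2 * ln (real n)"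
    and gm: "gm \<le> 2 * G"
  shows "emeasure (PiM {1..n} (\<lambda>_. M)) {x \<in> space (PiM {1..n} (\<lambda>_. M)).
      sqrt (V_pen K \<kappa> n G gm h / 6) \<le> \<bar>1 / real n * (\<Sum>i=1..n. summand L (x i)) - conv L f_plug x0\<bar>}
    \<le> ennreal (2 / real n ^ 12)"
proof -
  interpret prob_space M by (rule prob_space_M)
  have Lm: "L \<in> borel_measurable borel" using bounded_suppD[OF L(1)] by simp
  define l where "l = sqrt (V_pen K \<kappa> n G gm h / 6)"
  define t where "t = 24 * ln (real n) / (real n * l)"
  have n': "1 < real n" using n by simp
  note cal = Bernstein_calibration[OF n' h(1) \<delta>(1) G_pos K1_ge K2_pos gm_pos gm h(2) \<kappa> Kinf_nonneg Kinf
      W_nonneg W_def[THEN eq_refl] V_pen_def l_def t_def]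
  have "(LINT x|M. (summand L x)\<^sup>2) \<le> W\<^sup>2 * G * (K1\<^sup>2 * K2\<^sup>2 / h)"
    using G_pos by (intro order_trans[OF summand_second_moment[OF L(1)] mult_left_mono[OF L(2)]]) simp
  from Bernstein_mean[OF summand_measurable[OF Lm] summand_bound[OF L(1)] this cal(1-3), of n] n
  have "emeasure (PiM {1..n} (\<lambda>_. M)) {x \<in> space (PiM {1..n} (\<lambda>_. M)).
      l \<le> \<bar>1 / real n * (\<Sum>i=1..n. summand L (x i)) - conv L f_plug x0\<bar>}
    \<le> ennreal (2 * exp (- (real n * t * l / 2)))"
    using summand_mean[OF Lm] by simp
  also have "2 * exp (- (real n * t * l / 2)) = 2 / real n ^ 12"
  proof -
    have "exp (12 * ln (real n)) = real n ^ 12"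
      using n exp_of_nat_mult[of 12 "ln (real n)"] by simp
    then show ?thesis unfolding cal(4) exp_minus by (simp only: divide_inverse)
  qed
  finally show ?thesis by (simp add: l_def)
qed

text \<open>Without accuracy gm may be tiny, but A5 ties the bandwidth to it: 1/(h gm) is at most n
  / log^3 n. Together with 1/h <= n and Kinf <= n this makes the estimator of order n^2.\<close>

lemma crude_bound:
  assumes n: "1 < n" "1 \<le> ln (real n)" "Kinf \<le> real n"
    and bw: "0 < h" "a \<le> 1 / h" "1 / h \<le> gm * real n / (ln (real n))^3" "1 / h \<le> real n"
    and X: "\<And>i. i \<in> {1..n} \<Longrightarrow> X i \<in> {0..1}"
  shows "(f_est K n \<tau> gh X x0 h - f x0)\<^sup>2 \<le> (32 / \<delta>\<^sup>2 + 2 * F\<^sup>2) * real n ^ 4"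
proof -
  interpret bandwidth f \<theta> \<delta> K A a x0 h by unfold_locales (rule bw)+
  have "\<bar>f_est K n \<tau> gh X x0 h\<bar> = \<bar>\<Sum>i=1..n. summand (scaled K h) (X i)\<bar> / real n"
    unfolding f_est_def
    using weighted_est_eq[OF X, where L = "scaled K h"] admissible_kernels(5)[OF bw(1,2)]
    by (simp add: abs_mult)
  also have "\<dots> \<le> (\<Sum>i=1..n. W * (Kinf / h)) / real n"
    by (intro divide_right_mono order_trans[OF sum_abs] sum_mono summand_bound[OF Kh]) simp
  also have "\<dots> = W * (Kinf / h)" using n by simp
  also have "\<dots> = 2 / \<delta> * (Kinf * (1 / h + 1 / h / gm))"
    using gm_pos bw by (simp add: W_def field_simps)
  also have "\<dots> \<le> 2 / \<delta> * (real n * (real n + real n))"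
  proof (intro mult_left_mono mult_mono add_mono)
    have "1 / h / gm \<le> real n / (ln (real n))^3"
      using divide_right_mono[OF bw(3), of gm] gm_pos by simp
    also have "\<dots> \<le> real n / 1"
      using n one_le_power[OF n(2), of 3] by (intro divide_left_mono) auto
    finally show "1 / h / gm \<le> real n" by simp
  qed (use n bw \<delta> gm_pos Kinf_nonneg in auto)
  finally have "\<bar>f_est K n \<tau> gh X x0 h\<bar> \<le> 4 / \<delta> * (real n)\<^sup>2" by (simp add: power2_eq_square)
  then have "(f_est K n \<tau> gh X x0 h)\<^sup>2 \<le> (4 / \<delta> * (real n)\<^sup>2)\<^sup>2" by (rule square_le_if_abs_le)
  also have "\<dots> = 16 / \<delta>\<^sup>2 * real n ^ 4"
    by (simp add: power_mult_distrib power_divide flip: power_mult)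
  finally have "(f_est K n \<tau> gh X x0 h)\<^sup>2 \<le> 16 / \<delta>\<^sup>2 * real n ^ 4" .
  moreover have "(f x0)\<^sup>2 \<le> F\<^sup>2 * real n ^ 4"
  proof -
    have "(f x0)\<^sup>2 \<le> F\<^sup>2 * 1" using f_le_F[OF x0_in(2)] f_props(2) by (simp add: power_mono)
    also have "\<dots> \<le> F\<^sup>2 * real n ^ 4" using n by (intro mult_left_mono) auto
    finally show ?thesis .
  qed
  ultimately show ?thesis
    using sum2_sq_le[of "f_est K n \<tau> gh X x0 h" "- f x0"] by (simp add: algebra_simps)
qed

lemma good_bound:
  assumes ratio: "\<And>t. t \<in> I \<Longrightarrow> \<bar>gh t - g t\<bar> \<le> \<bar>gh t\<bar> / 2"
    and s: "\<And>t. t \<in> I \<Longrightarrow> \<bar>gh t - g t\<bar> \<le> s"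
    and n: "1 < n" and \<kappa>: "0 < \<kappa>"
    and H: "finite H" "h \<in> H" "\<And>h. h \<in> H \<Longrightarrow> 0 < h" "\<And>h. h \<in> H \<Longrightarrow> a \<le> 1 / h"
    and X: "\<And>i. i \<in> {1..n} \<Longrightarrow> X i \<in> {0..1}"
    and min: "is_arg_min (\<lambda>h. A_term K \<kappa> H n G gm \<tau> gh X x0 h + V_pen K \<kappa> n G gm h) (\<lambda>h. h \<in> H) hs"
    and dev: "\<And>h'. h' \<in> H \<Longrightarrow> \<bar>1 / real n * (\<Sum>i=1..n. summand (scaled K h') (X i))
        - conv (scaled K h') f_plug x0\<bar> \<le> sqrt (V_pen K \<kappa> n G gm h' / 6)"
    and dev2: "\<And>h'. h' \<in> H \<Longrightarrow> \<bar>1 / real n * (\<Sum>i=1..n. summand (conv (scaled K h) (scaled K h')) (X i))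
        - conv (conv (scaled K h) (scaled K h')) f_plug x0\<bar> \<le> sqrt (V_pen K \<kappa> n G gm h' / 6)"
  shows "(f_est K n \<tau> gh X x0 hs - f x0)\<^sup>2
    \<le> (48 * K1\<^sup>2 + 28 * \<kappa> * K1\<^sup>2 * K2\<^sup>2 * G) * ((bias h)\<^sup>2 + ln (real n) / (\<delta>\<^sup>2 * \<gamma>\<^sup>2 * real n * h))
      + 1248 * K1^4 * (G + 1)\<^sup>2 / \<delta>^6 * \<bar>\<tau> - \<theta>\<bar>\<^sup>2 + 4992 * K1^4 / (\<delta>\<^sup>2 * \<gamma>\<^sup>2) * s\<^sup>2"
proof -
  have h: "0 < h" "a \<le> 1 / h" using H by auto
  interpret bandwidth f \<theta> \<delta> K A a x0 h by unfold_locales (rule h)+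
  define \<epsilon> where "\<epsilon> = 2 / \<delta> * (s / gm) + 2 / \<delta>\<^sup>2 * (G + 1) * \<bar>\<tau> - \<theta>\<bar>"
  have s0: "0 \<le> s" using s[OF x0_in(1)] by (rule order_trans[OF abs_ge_zero])
  have \<epsilon>0: "0 \<le> \<epsilon>" using s0 gm_pos \<delta> G_pos by (simp add: \<epsilon>_def)
  have e: "\<bar>f_plug t - f_loc t\<bar> \<le> \<epsilon>" for t
    unfolding \<epsilon>_def by (rule f_plug_error[OF s])
  define e1 where "e1 h' = f_est K n \<tau> gh X x0 h'" for h'
  define e2 where "e2 h h' = f_est2 K n \<tau> gh X x0 h h'" for h h'
  define V where "V = V_pen K \<kappa> n G gm"
  have V0: "0 \<le> V h'" if "h' \<in> H" for h'
    using H(3)[OF that] \<kappa> n G_pos by (simp add: V_def V_pen_def)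
  have sq: "x\<^sup>2 \<le> V h' / 6" if "\<bar>x\<bar> \<le> sqrt (V h' / 6)" "h' \<in> H" for x h'
    using square_le_if_abs_le[OF that(1)] V0[OF that(2)] by simp
  have "(e1 hs - f x0)\<^sup>2 \<le> 18 * (K1 * (bias h + (K1 + 1) * \<epsilon>))\<^sup>2 + 6 * (bias h + K1 * \<epsilon>)\<^sup>2 + 7 * V h"
  proof (rule Goldenshluger_Lepski_oracle[OF H(1,2), where e = e1 and ee = e2 and V = V
        and m = "\<lambda>h'. conv (scaled K h') f_plug x0"
        and mm = "\<lambda>h'. conv (conv (scaled K h) (scaled K h')) f_plug x0"])
    show "is_arg_min (\<lambda>h. Max ((\<lambda>h'. max 0 ((e2 h h' - e1 h')\<^sup>2 - V h')) ` H) + V h) (\<lambda>h. h \<in> H) hs"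
      using min by (simp add: A_term_def e1_def e2_def V_def)
    show "e2 h h' = e2 h' h" for h h'
      unfolding e2_def f_est2_def by (subst conv_commute) (rule refl)
    fix h' assume h'H: "h' \<in> H"
    then have h': "0 < h'" "a \<le> 1 / h'" using H by auto
    show "(e1 h' - conv (scaled K h') f_plug x0)\<^sup>2 \<le> V h' / 6"
      using sq[OF dev[folded V_def, OF h'H] h'H]
        weighted_est_eq[OF X, where L = "scaled K h'"] admissible_kernels(5)[OF h']
      by (simp add: e1_def f_est_def)
    show "(e2 h h' - conv (conv (scaled K h) (scaled K h')) f_plug x0)\<^sup>2 \<le> V h' / 6"
      using sq[OF dev2[folded V_def, OF h'H] h'H]
        weighted_est_eq[OF X, where L = "conv (scaled K h) (scaled K h')"] admissible_kernels(6)[OF h']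
      by (simp add: e2_def f_est2_def)
    show "\<bar>conv (conv (scaled K h) (scaled K h')) f_plug x0 - conv (scaled K h') f_plug x0\<bar>
        \<le> K1 * (bias h + (K1 + 1) * \<epsilon>)"
      by (rule bias_double[OF h' f_plug_bounded_supp e])
  next
    show "\<bar>conv (scaled K h) f_plug x0 - f x0\<bar> \<le> bias h + K1 * \<epsilon>"
      by (rule bias_point_x0[OF f_plug_bounded_supp e])
  qed
  \<comment> \<open>With K1 + 1 <= 2 K1 and K1 >= 1 the coefficients are 48 = 18 * 2 + 6 * 2 and 156
    = 18 * 8 + 6 * 2.\<close>
  moreover have "18 * (K1 * (bias h + (K1 + 1) * \<epsilon>))\<^sup>2 + 6 * (bias h + K1 * \<epsilon>)\<^sup>2
      \<le> 48 * K1\<^sup>2 * (bias h)\<^sup>2 + 156 * K1^4 * \<epsilon>\<^sup>2"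
  proof -
    have K12: "1 \<le> K1\<^sup>2" "K1\<^sup>2 \<le> K1^4"
      using one_le_power[OF K1_ge, of 2] power_increasing[OF _ K1_ge, of 2 4] by auto
    have "(K1 * (bias h + (K1 + 1) * \<epsilon>))\<^sup>2 = K1\<^sup>2 * (bias h + (K1 + 1) * \<epsilon>)\<^sup>2"
      by (simp add: power_mult_distrib)
    also have "\<dots> \<le> K1\<^sup>2 * (2 * (bias h)\<^sup>2 + 2 * ((2 * K1) * \<epsilon>)\<^sup>2)"
    proof (rule mult_left_mono[OF order_trans[OF sum2_sq_le]])
      have "((K1 + 1) * \<epsilon>)\<^sup>2 \<le> ((2 * K1) * \<epsilon>)\<^sup>2"
        using K1_ge \<epsilon>0 by (intro power_mono mult_right_mono) auto
      then show "2 * (bias h)\<^sup>2 + 2 * ((K1 + 1) * \<epsilon>)\<^sup>2 \<le> 2 * (bias h)\<^sup>2 + 2 * ((2 * K1) * \<epsilon>)\<^sup>2"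
        by simp
    qed simp
    also have "\<dots> = 2 * (K1\<^sup>2 * (bias h)\<^sup>2) + 8 * (K1^4 * \<epsilon>\<^sup>2)"
      by (simp add: power2_eq_square power4_eq_xxxx algebra_simps)
    finally have 1: "(K1 * (bias h + (K1 + 1) * \<epsilon>))\<^sup>2 \<le> 2 * (K1\<^sup>2 * (bias h)\<^sup>2) + 8 * (K1^4 * \<epsilon>\<^sup>2)" .
    have 2: "(bias h + K1 * \<epsilon>)\<^sup>2 \<le> 2 * (bias h)\<^sup>2 + 2 * (K1\<^sup>2 * \<epsilon>\<^sup>2)"
      using sum2_sq_le[of "bias h" "K1 * \<epsilon>"] by (simp add: power_mult_distrib)
    have 3: "1 * (bias h)\<^sup>2 \<le> K1\<^sup>2 * (bias h)\<^sup>2"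
      by (rule mult_right_mono[OF K12(1)]) simp
    have 4: "K1\<^sup>2 * \<epsilon>\<^sup>2 \<le> K1^4 * \<epsilon>\<^sup>2"
      by (rule mult_right_mono[OF K12(2)]) simp
    show ?thesis using 1 2 3 4 by linarith
  qed
  moreover have "7 * V h \<le> 28 * \<kappa> * K1\<^sup>2 * K2\<^sup>2 * G * (ln (real n) / (\<delta>\<^sup>2 * \<gamma>\<^sup>2 * real n * h))"
    and "156 * K1^4 * \<epsilon>\<^sup>2 \<le> 1248 * K1^4 * (G + 1)\<^sup>2 / \<delta>^6 * \<bar>\<tau> - \<theta>\<bar>\<^sup>2 + 4992 * K1^4 / (\<delta>\<^sup>2 * \<gamma>\<^sup>2) * s\<^sup>2"
  proof -
    \<comment> \<open>The ratio bound gives g <= 3 |gh| / 2, so gm is even at least 2 \<gamma> / 3;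
      the value \<gamma> / 2 yields the round factor 4.\<close>
    have "\<gamma> / 2 \<le> gm"
      unfolding inf_abs_def[of I gh]
    proof (rule cINF_greatest)
      show "I \<noteq> {}" using x0_in by auto
      fix t assume t: "t \<in> I"
      show "\<gamma> / 2 \<le> \<bar>gh t\<bar>"
        using \<gamma>_le[OF t] ratio[OF t] \<gamma>_pos by (auto simp: abs_if split: if_splits)
    qed
    then have "(\<gamma> / 2)\<^sup>2 \<le> gm\<^sup>2" using \<gamma>_pos by (intro power_mono) auto
    then have gm: "1 / gm\<^sup>2 \<le> 4 / \<gamma>\<^sup>2"
      using \<gamma>_pos gm_pos by (simp add: power_divide field_simps)
    \<comment> \<open>These two inequalities adapt the powers of \<delta> to the claimed form: the
      computation itself gives \<delta>^-4 for the error of \<tau> and no explicit \<delta> in the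
      variance term.\<close>
    have d1: "1 \<le> 1 / \<delta>\<^sup>2" using \<delta> power_le_one[of \<delta> 2] by simp
    have d2: "1 / \<delta>^4 \<le> 1 / \<delta>^6" using \<delta> by (intro frac_le power_decreasing) auto
    have "V h = \<kappa> * K1\<^sup>2 * K2\<^sup>2 * G * (ln (real n) / (real n * h)) * (1 / gm\<^sup>2)"
      by (simp add: V_def V_pen_def)
    also have "\<dots> \<le> \<kappa> * K1\<^sup>2 * K2\<^sup>2 * G * (ln (real n) / (real n * h)) * (4 / \<gamma>\<^sup>2)"
      using gm \<kappa> G_pos n h by (intro mult_left_mono) auto
    also have "\<dots> = 4 * \<kappa> * K1\<^sup>2 * K2\<^sup>2 * G * (ln (real n) / (real n * h)) * (1 / \<gamma>\<^sup>2) * 1"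
      by simp
    also have "\<dots> \<le> 4 * \<kappa> * K1\<^sup>2 * K2\<^sup>2 * G * (ln (real n) / (real n * h)) * (1 / \<gamma>\<^sup>2) * (1 / \<delta>\<^sup>2)"
      using d1 \<kappa> G_pos n h by (intro mult_left_mono) auto
    finally have "7 * V h \<le> 7 * (4 * \<kappa> * K1\<^sup>2 * K2\<^sup>2 * G * (ln (real n) / (real n * h)) * (1 / \<gamma>\<^sup>2) * (1 / \<delta>\<^sup>2))"
      by (rule mult_left_mono) simp
    also have "\<dots> = 28 * \<kappa> * K1\<^sup>2 * K2\<^sup>2 * G * (ln (real n) / (\<delta>\<^sup>2 * \<gamma>\<^sup>2 * real n * h))"
      by (simp add: mult_ac)
    finally show "7 * V h \<le> 28 * \<kappa> * K1\<^sup>2 * K2\<^sup>2 * G * (ln (real n) / (\<delta>\<^sup>2 * \<gamma>\<^sup>2 * real n * h))" .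
    have square: "2 * (2 / \<delta> * (s / gm))\<^sup>2 + 2 * (2 / \<delta>\<^sup>2 * q * r)\<^sup>2
        = 8 * s\<^sup>2 / \<delta>\<^sup>2 * (1 / gm\<^sup>2) + 8 * q\<^sup>2 * r\<^sup>2 * (1 / \<delta>^4)" for q r
      by (simp add: power_mult_distrib power_divide flip: power_mult)
    have "\<epsilon>\<^sup>2 \<le> 2 * (2 / \<delta> * (s / gm))\<^sup>2 + 2 * (2 / \<delta>\<^sup>2 * (G + 1) * \<bar>\<tau> - \<theta>\<bar>)\<^sup>2"
      unfolding \<epsilon>_def by (rule sum2_sq_le)
    also have "\<dots> = 8 * s\<^sup>2 / \<delta>\<^sup>2 * (1 / gm\<^sup>2) + 8 * (G + 1)\<^sup>2 * \<bar>\<tau> - \<theta>\<bar>\<^sup>2 * (1 / \<delta>^4)"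
      by (rule square)
    also have "\<dots> \<le> 8 * s\<^sup>2 / \<delta>\<^sup>2 * (4 / \<gamma>\<^sup>2) + 8 * (G + 1)\<^sup>2 * \<bar>\<tau> - \<theta>\<bar>\<^sup>2 * (1 / \<delta>^6)"
      using gm d2 by (intro add_mono mult_left_mono) auto
    finally have "156 * K1^4 * \<epsilon>\<^sup>2 \<le> 156 * K1^4 *
        (8 * s\<^sup>2 / \<delta>\<^sup>2 * (4 / \<gamma>\<^sup>2) + 8 * (G + 1)\<^sup>2 * \<bar>\<tau> - \<theta>\<bar>\<^sup>2 * (1 / \<delta>^6))"
      by (intro mult_left_mono) auto
    then show "156 * K1^4 * \<epsilon>\<^sup>2 \<le> 1248 * K1^4 * (G + 1)\<^sup>2 / \<delta>^6 * \<bar>\<tau> - \<theta>\<bar>\<^sup>2 + 4992 * K1^4 / (\<delta>\<^sup>2 * \<gamma>\<^sup>2) * s\<^sup>2"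
      by (simp add: distrib_left mult_ac)
  qed
  moreover have "(48 * K1\<^sup>2 + 28 * \<kappa> * K1\<^sup>2 * K2\<^sup>2 * G) * ((bias h)\<^sup>2 + ln (real n) / (\<delta>\<^sup>2 * \<gamma>\<^sup>2 * real n * h))
     \<ge> 48 * K1\<^sup>2 * (bias h)\<^sup>2 + 28 * \<kappa> * K1\<^sup>2 * K2\<^sup>2 * G * (ln (real n) / (\<delta>\<^sup>2 * \<gamma>\<^sup>2 * real n * h))"
  proof -
    have "0 \<le> 28 * \<kappa> * K1\<^sup>2 * K2\<^sup>2 * G * (bias h)\<^sup>2"
      "0 \<le> 48 * K1\<^sup>2 * (ln (real n) / (\<delta>\<^sup>2 * \<gamma>\<^sup>2 * real n * h))"
      using \<kappa> G_pos n h by auto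
    then show ?thesis unfolding distrib_left distrib_right by linarith
  qed
  ultimately show ?thesis unfolding e1_def by linarith
qed

end

section \<open>Averaging over the preliminary sample\<close>

text \<open>Fubini over the two halves of the sample. For a frozen second half z the event concerns
  the first n coordinates only, as \<open>loc\<close> guarantees, and a bound uniform in z survives
  averaging over z.\<close>

lemma emeasure_split_sample:
  fixes M :: "real measure"
  assumes M: "prob_space M"
    and E: "{X \<in> space (PiM {1..2*n} (\<lambda>_. M)). Q (second_half n X) X} \<in> sets (PiM {1..2*n} (\<lambda>_. M))"
    and loc: "\<And>z X X'. (\<And>i. i \<in> {1..n} \<Longrightarrow> X i = X' i) \<Longrightarrow> Q z X = Q z X'"
    and bound: "\<And>z. z \<in> space (PiM {n+1..2*n} (\<lambda>_. M)) \<Longrightarrow>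
      emeasure (PiM {1..n} (\<lambda>_. M)) {X \<in> space (PiM {1..n} (\<lambda>_. M)). Q z X} \<le> c"
  shows "emeasure (PiM {1..2*n} (\<lambda>_. M)) {X \<in> space (PiM {1..2*n} (\<lambda>_. M)). Q (second_half n X) X} \<le> c"
proof -
  interpret M: prob_space M by (rule M)
  interpret product_sigma_finite "\<lambda>_. M"
    by unfold_locales
  interpret Z: prob_space "PiM {n+1..2*n} (\<lambda>_. M)"
    using M by (intro prob_space_PiM)
  let ?Z = "{n+1..2*n}" and ?X = "{1..n}"
  let ?E = "{X \<in> space (PiM {1..2*n} (\<lambda>_. M)). Q (second_half n X) X}"
  have U: "?Z \<union> ?X = {1..2*n}" by auto
  have meas: "indicator ?E \<in> borel_measurable (PiM {1..2*n} (\<lambda>_. M))" using E by simp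
  have "emeasure (PiM {1..2*n} (\<lambda>_. M)) ?E = (\<integral>\<^sup>+X. indicator ?E X \<partial>PiM (?Z \<union> ?X) (\<lambda>_. M))"
    using E by (simp only: U nn_integral_indicator)
  also have "\<dots> = (\<integral>\<^sup>+z. (\<integral>\<^sup>+x. indicator ?E (merge ?Z ?X (z, x)) \<partial>PiM ?X (\<lambda>_. M)) \<partial>PiM ?Z (\<lambda>_. M))"
    by (rule product_nn_integral_fold) (use meas U in auto)
  also have "\<dots> \<le> (\<integral>\<^sup>+z. c \<partial>PiM ?Z (\<lambda>_. M))"
  proof (rule nn_integral_mono)
    fix z assume z: "z \<in> space (PiM ?Z (\<lambda>_. M))"
    define S where "S = {X \<in> space (PiM ?X (\<lambda>_. M)). Q z X}"
    have mZ: "(\<lambda>x. merge ?Z ?X (z, x)) \<in> PiM ?X (\<lambda>_. M) \<rightarrow>\<^sub>M PiM {1..2*n} (\<lambda>_. M)"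
      using measurable_compose[OF measurable_Pair1'[OF z, of "PiM ?X (\<lambda>_. M)"] measurable_merge[of ?Z ?X "\<lambda>_. M"]]
      by (simp only: U)
    have iff: "merge ?Z ?X (z, x) \<in> ?E \<longleftrightarrow> x \<in> S" if x: "x \<in> space (PiM ?X (\<lambda>_. M))" for x
    proof -
      \<comment> \<open>As z is extensional, restricting the merged sample returns z itself and not
        merely a function agreeing with it on the index set.\<close>
      have "second_half n (merge ?Z ?X (z, x)) = z"
        using z by (auto simp: second_half_def fun_eq_iff merge_def restrict_def space_PiM PiE_def extensional_def)
      moreover have "Q z (merge ?Z ?X (z, x)) = Q z x"
        by (rule loc) (auto simp: merge_def)
      moreover have "merge ?Z ?X (z, x) \<in> space (PiM {1..2*n} (\<lambda>_. M))"
        using measurable_space[OF mZ x] .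
      ultimately show ?thesis using x by (simp add: S_def)
    qed
    have "S = (\<lambda>x. merge ?Z ?X (z, x)) -` ?E \<inter> space (PiM ?X (\<lambda>_. M))"
      using iff by (auto simp: S_def)
    then have S: "S \<in> sets (PiM ?X (\<lambda>_. M))" using measurable_sets[OF mZ E] by simp
    have "(\<integral>\<^sup>+x. indicator ?E (merge ?Z ?X (z, x)) \<partial>PiM ?X (\<lambda>_. M)) = (\<integral>\<^sup>+x. indicator S x \<partial>PiM ?X (\<lambda>_. M))"
      using iff by (intro nn_integral_cong) (auto simp: indicator_def)
    also have "\<dots> \<le> c" using S bound[OF z] by (simp add: S_def)
    finally show "(\<integral>\<^sup>+x. indicator ?E (merge ?Z ?X (z, x)) \<partial>PiM ?X (\<lambda>_. M)) \<le> c" .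
  qed
  also have "\<dots> = c" using Z.emeasure_space_1 by simp
  finally show ?thesis .
qed

text \<open>The exponent 6 is the sum of the 4 of the crude bound and the 2 of the target rate. With
  L = ln n, L sqrt L overtakes 6 L at L = 36, where 6 L = 216.\<close>

lemma exp_ln_powr_decay:
  fixes n :: nat
  assumes n: "1 < n"
  shows "real n ^ 6 * exp (- (ln (real n) powr (3/2))) \<le> exp 216"
proof -
  define L where "L = ln (real n)"
  have L: "0 < L" using n by (simp add: L_def)
  have "6 * L - L powr (3/2) \<le> 216"
  proof (cases "L \<le> 36")
    case True
    moreover have "0 \<le> L powr (3/2)" by simp
    ultimately show ?thesis by linarith
  next
    case False
    have "L powr (3/2) = L powr (1 + 1/2)" by simp
    also have "\<dots> = L * sqrt L" unfolding powr_add using L by (simp add: powr_half_sqrt)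
    also have "\<dots> \<ge> L * 6"
      using False L real_le_rsqrt[of 6 L] by (intro mult_left_mono) auto
    finally show ?thesis by simp
  qed
  moreover have "real n ^ 6 = exp (6 * L)"
    using n exp_of_nat_mult[of 6 L] by (simp add: L_def)
  ultimately show ?thesis by (simp add: L_def exp_add[symmetric])
qed

section \<open>The random sample: exceptional events and the risk for a fixed oracle
  bandwidth\<close>

locale adaptive_estimation = mixture_model +
  fixes n :: nat and \<kappa> :: real and H :: "real set" and \<theta>est :: "(nat \<Rightarrow> real) \<Rightarrow> real"
    and gest :: "(nat \<Rightarrow> real) \<Rightarrow> real \<Rightarrow> real" and hsel :: "(nat \<Rightarrow> real) \<Rightarrow> real" and C :: "real \<Rightarrow> real"
  assumes prelim: "preliminary_estimators n I g \<theta>est gest"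
    and H: "finite H" "H \<noteq> {}" "card H \<le> n" "\<forall>h\<in>H. 0 < h"
    and \<kappa>: "0 < \<kappa>" "48^3 * (1 + 2 * G)\<^sup>2 / \<delta>\<^sup>2 \<le> \<kappa>"
    and sel: "selected_bandwidth K \<kappa> H n G I \<theta>est gest x0 hsel"
    and A2: "assm_A2 (sample_law \<theta> f n) n I gest"
    and A3: "assm_A3 (sample_law \<theta> f n) n I g gest C"
    and A4: "assm_A4 (sample_law \<theta> f n) n \<delta> \<theta>est"
    and A5: "\<forall>h\<in>H. assm_A5 (sample_law \<theta> f n) n I gest a h"
    and n_large: "3 + K1 + Kinf + exp (Kinf / K2) < real n"
begin

abbreviation "P \<equiv> sample_law \<theta> f n"

text \<open>In the sample size threshold, 3 >= e yields ln n >= 1, Kinf serves the crude bound, and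
  the exponential is there for Bernstein's linear term.\<close>

lemma n_props: "1 < n" "1 \<le> ln (real n)" "Kinf \<le> real n" "Kinf \<le> K2 * ln (real n)"
proof -
  have e: "0 < exp (Kinf / K2)" by simp
  show "1 < n" "Kinf \<le> real n" using n_large K1_ge Kinf_nonneg e by linarith+
  have "exp 1 \<le> real n" using n_large K1_ge Kinf_nonneg e exp_le by linarith
  then show "1 \<le> ln (real n)" using \<open>1 < n\<close> by (subst ln_ge_iff) auto
  have "exp (Kinf / K2) \<le> real n" using n_large K1_ge Kinf_nonneg by linarith
  then have "Kinf / K2 \<le> ln (real n)" using \<open>1 < n\<close> by (subst ln_ge_iff) auto
  then show "Kinf \<le> K2 * ln (real n)" using K2_pos by (simp add: field_simps)
qed

lemma sets_P [measurable_cong]: "sets P = sets (PiM {1..2*n} (\<lambda>_. borel))"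
  unfolding sample_law_def by (intro sets_PiM_cong) auto

lemma space_P: "space P = space (PiM {1..2*n} (\<lambda>_. borel :: real measure))"
  by (rule sets_eq_imp_space_eq[OF sets_P])

lemma prob_space_P: "prob_space P"
  unfolding sample_law_def using prob_space_M by (intro prob_space_PiM)

lemma second_half_measurable [measurable]: "second_half n \<in> P \<rightarrow>\<^sub>M half_space n"
  unfolding measurable_cong_sets[OF sets_P refl] second_half_def
  by (rule measurable_restrict_subset) auto

lemma coordinate_measurable: "i \<in> {1..n} \<Longrightarrow> (\<lambda>X. X i) \<in> borel_measurable P"
  unfolding measurable_cong_sets[OF sets_P refl]
  by (rule measurable_component_singleton) auto

lemma prelim_measurable [measurable]:
  "\<theta>est \<in> borel_measurable (half_space n)"
  "(\<lambda>(z, t). gest z t) \<in> borel_measurable (half_space n \<Otimes>\<^sub>M borel)"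
  "(\<lambda>z. inf_abs I (gest z)) \<in> borel_measurable (half_space n)"
  "(\<lambda>z. esup_norm I (\<lambda>t. (gest z t - g t) / gest z t)) \<in> borel_measurable (half_space n)"
  "(\<lambda>z. esup_norm I (\<lambda>t. gest z t - g t)) \<in> borel_measurable (half_space n)"
  using prelim unfolding preliminary_estimators_def by auto

definition regular :: "(nat \<Rightarrow> real) \<Rightarrow> bool" where
  "regular z \<longleftrightarrow> \<theta>est z \<in> {\<delta>/2 .. 1 - \<delta>/2} \<and> 0 < inf_abs I (gest z) \<and>
     (\<forall>h\<in>H. a \<le> 1 / h \<and> 1 / h \<le> min (inf_abs I (gest z) * real n / (ln (real n))^3) (real n))"

text \<open>The complement of the A3 event at \<nu> = 1/2. With this ratio, gm is squeezed between
  \<gamma> / 2 and 2 G.\<close>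

definition accurate :: "(nat \<Rightarrow> real) \<Rightarrow> bool" where
  "accurate z \<longleftrightarrow> esup_norm I (\<lambda>t. (gest z t - g t) / gest z t) \<le> ennreal (1/2)"

text \<open>Regularity and accuracy are built into the event because the tail bound is available
  only then. For any other z the event is empty, so the bound holds for every z, as the splitting of
  the sample requires.\<close>

definition deviation :: "(real \<Rightarrow> real) \<Rightarrow> real \<Rightarrow> (nat \<Rightarrow> real) \<Rightarrow> (nat \<Rightarrow> real) \<Rightarrow> bool" where
  "deviation L h z X \<longleftrightarrow> regular z \<and> accurate z \<and>
     sqrt (V_pen K \<kappa> n G (inf_abs I (gest z)) h / 6)
     \<le> \<bar>1 / real n * (\<Sum>i=1..n. plug_summand I (\<theta>est z) (gest z) x0 L (X i))
         - conv L (plug_in I g (\<theta>est z) (gest z)) x0\<bar>"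

lemma gest_measurable: "z \<in> space (half_space n) \<Longrightarrow> gest z \<in> borel_measurable borel"
  using measurable_compose[OF measurable_Pair1' prelim_measurable(2)] by simp

lemma plugin_regular:
  assumes "z \<in> space (half_space n)" "regular z"
  shows "plugin f \<theta> \<delta> K A a x0 (\<theta>est z) (gest z)"
  using assms gest_measurable by unfold_locales (auto simp: regular_def)

lemma accurateD:
  assumes acc: "accurate z" and pos: "0 < inf_abs I (gest z)" and t: "t \<in> I"
  shows "\<bar>gest z t - g t\<bar> \<le> \<bar>gest z t\<bar> / 2"
proof -
  have "inf_abs I (gest z) \<le> \<bar>gest z t\<bar>"
    unfolding inf_abs_def using t by (intro cINF_lower) (auto intro!: bdd_belowI2[of _ 0])
  \<comment> \<open>Division by zero yields zero, so a vanishing estimate would satisfy the ratio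
    bound trivially; a positive infimum excludes this.\<close>
  then have y: "0 < \<bar>gest z t\<bar>" using pos by simp
  have "ennreal \<bar>(gest z t - g t) / gest z t\<bar> \<le> esup_norm I (\<lambda>t. (gest z t - g t) / gest z t)"
    unfolding esup_norm_def using t by (rule SUP_upper)
  also have "\<dots> \<le> ennreal (1/2)" using acc by (simp add: accurate_def)
  finally have "\<bar>(gest z t - g t) / gest z t\<bar> \<le> 1/2"
    by (rule ennreal_le_iff[THEN iffD1, rotated]) simp
  then show ?thesis using y by (simp add: abs_divide field_simps)
qed

lemma accurate_gm_le:
  assumes acc: "accurate z" and pos: "0 < inf_abs I (gest z)"
  shows "inf_abs I (gest z) \<le> 2 * G"
proof -
  have "inf_abs I (gest z) \<le> \<bar>gest z x0\<bar>"
    unfolding inf_abs_def using x0_in by (intro cINF_lower) (auto intro!: bdd_belowI2[of _ 0])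
  also have "\<dots> \<le> 2 * g x0"
    using accurateD[OF acc pos x0_in(1)] g_nonneg[of x0] by (auto simp: abs_if split: if_splits)
  also have "\<dots> \<le> 2 * G" using g_le_G[OF x0_in(1)] by simp
  finally show ?thesis .
qed

text \<open>The delicate term is the centring, a parameter integral in z; joint measurability of
  \<open>gest\<close> in z and t makes it measurable.\<close>

lemma deviation_measurable:
  assumes [measurable]: "L \<in> borel_measurable borel"
  shows "{X \<in> space P. deviation L h (second_half n X) X} \<in> sets P"
proof -
  have [measurable]: "Measurable.pred (half_space n) regular"
    unfolding regular_def using H(1) by measurable
  have [measurable]: "Measurable.pred (half_space n) accurate"
    unfolding accurate_def by measurable
  define S where "S z x = plug_summand I (\<theta>est z) (gest z) x0 L x" for z x
  define m where "m z = conv L (plug_in I g (\<theta>est z) (gest z)) x0" for z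
  define v where "v z = sqrt (V_pen K \<kappa> n G (inf_abs I (gest z)) h / 6)" for z
  have S: "(\<lambda>(z, x). S z x) \<in> borel_measurable (half_space n \<Otimes>\<^sub>M borel)"
    unfolding S_def plug_summand_def weight_def by measurable
  have [measurable]: "m \<in> borel_measurable (half_space n)"
    unfolding m_def conv_def plug_in_def weight_def
    by (rule lborel.borel_measurable_lebesgue_integral) measurable
  have [measurable]: "v \<in> borel_measurable (half_space n)"
    unfolding v_def V_pen_def by measurable
  define T where "T X = (\<Sum>i=1..n. S (second_half n X) (X i))" for X
  have [measurable]: "T \<in> borel_measurable P"
    unfolding T_def
  proof (rule borel_measurable_sum)
    fix i assume "i \<in> {1..n}"
    then show "(\<lambda>X. S (second_half n X) (X i)) \<in> borel_measurable P"
      using measurable_compose[OF measurable_Pair[OF second_half_measurable coordinate_measurable] S] by simp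
  qed
  have "{X \<in> space P. deviation L h (second_half n X) X} = {X \<in> space P. regular (second_half n X) \<and>
      accurate (second_half n X) \<and> v (second_half n X)
        \<le> \<bar>1 / real n * T X - m (second_half n X)\<bar>}"
    by (simp add: deviation_def v_def T_def S_def m_def)
  also have "\<dots> \<in> sets P"
  proof (intro sets.sets_Collect_conj borel_measurable_le)
    have comp: "(\<lambda>X. u (second_half n X)) \<in> borel_measurable P"
      if "u \<in> borel_measurable (half_space n)" for u :: "(nat \<Rightarrow> real) \<Rightarrow> real"
      using measurable_compose[OF second_half_measurable that] .
    have "v \<in> borel_measurable (half_space n)" "m \<in> borel_measurable (half_space n)"
      by measurable
    note vm = this[THEN comp]
    show "(\<lambda>X. v (second_half n X)) \<in> borel_measurable P" by (rule vm)
    show "(\<lambda>X. \<bar>1 / real n * T X - m (second_half n X)\<bar>) \<in> borel_measurable P"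
      using \<open>T \<in> borel_measurable P\<close> vm(2)
      by (intro borel_measurable_abs borel_measurable_diff borel_measurable_times) auto
  qed measurable
  finally show ?thesis .
qed

lemma deviation_prob_le:
  assumes h: "h \<in> H" and L: "bounded_supp (K1 * Kinf / h) R L" "(LINT x|lborel. (L x)\<^sup>2) \<le> K1\<^sup>2 * K2\<^sup>2 / h"
  shows "emeasure P {X \<in> space P. deviation L h (second_half n X) X} \<le> ennreal (2 / real n ^ 12)"
  unfolding sample_law_def
proof (rule emeasure_split_sample[OF prob_space_M])
  show "{X \<in> space (Pi\<^sub>M {1..2 * n} (\<lambda>_. M)). deviation L h (second_half n X) X} \<in> sets (Pi\<^sub>M {1..2 * n} (\<lambda>_. M))"
    using deviation_measurable[of L h] bounded_suppD[OF L(1)] by (simp add: sample_law_def)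
  show "deviation L h z X = deviation L h z X'" if "\<And>i. i \<in> {1..n} \<Longrightarrow> X i = X' i" for z X X'
  proof -
    have "(\<Sum>i=1..n. plug_summand I (\<theta>est z) (gest z) x0 L (X i))
        = (\<Sum>i=1..n. plug_summand I (\<theta>est z) (gest z) x0 L (X' i))"
      using that by (intro sum.cong) auto
    then show ?thesis by (simp only: deviation_def)
  qed
  fix z assume "z \<in> space (Pi\<^sub>M {n+1..2*n} (\<lambda>_. M))"
  then have z: "z \<in> space (half_space n)" by (simp add: space_PiM)
  show "emeasure (Pi\<^sub>M {1..n} (\<lambda>_. M)) {X \<in> space (Pi\<^sub>M {1..n} (\<lambda>_. M)). deviation L h z X} \<le> ennreal (2 / real n ^ 12)"
  proof (cases "regular z \<and> accurate z")
    case True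
    interpret plugin f \<theta> \<delta> K A a x0 "\<theta>est z" "gest z"
      using plugin_regular[OF z] True by simp
    have "0 < h" "1 / h \<le> gm * real n / (ln (real n))^3"
      using True h H by (auto simp: regular_def)
    then show ?thesis
      using deviation_prob[OF n_props(1) _ _ L \<kappa>(2) n_props(4) accurate_gm_le] True gm_pos
      by (simp add: deviation_def)
  next
    case False
    then have "\<not> deviation L h z X" for X unfolding deviation_def by blast
    then show ?thesis by simp
  qed
qed

lemma inaccurate_prob_le:
  "emeasure P {X \<in> space P. \<not> accurate (second_half n X)}
    \<le> ennreal (\<bar>C (1/2)\<bar> * exp (- (ln (real n) powr (3/2))))"
proof -
  interpret P: prob_space P by (rule prob_space_P)
  have "measure P {X \<in> space P. \<not> accurate (second_half n X)} \<le> C (1/2) * exp (- (ln (real n) powr (3/2)))"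
    using A3[unfolded assm_A3_def, rule_format, OF half_gt_zero[OF zero_less_one]]
    unfolding accurate_def not_le .
  also have "\<dots> \<le> \<bar>C (1/2)\<bar> * exp (- (ln (real n) powr (3/2)))"
    by (intro mult_right_mono) auto
  finally show ?thesis unfolding P.emeasure_eq_measure by (rule ennreal_leI)
qed

lemma AE_regular: "AE X in P. regular (second_half n X)"
proof -
  have "AE X in P. \<forall>h\<in>H. a \<le> 1 / h \<and>
      1 / h \<le> min (inf_abs I (gest (second_half n X)) * real n / (ln (real n))^3) (real n)"
    using A5 H(1) unfolding assm_A5_def by (intro AE_finite_allI) auto
  then show ?thesis
    using A2 A4 unfolding assm_A2_def assm_A4_def regular_def by eventually_elim auto
qed

lemma AE_sample_unit: "AE X in P. \<forall>i\<in>{1..n}. X i \<in> {0..1}"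
proof (rule AE_finite_allI)
  fix i assume "i \<in> {1..n}"
  then show "AE X in P. X i \<in> {0..1}"
    unfolding sample_law_def using prob_space_M AE_M_unit
    by (intro AE_PiM_component[where M = "\<lambda>_. M"]) auto
qed simp

lemma hsel_min:
  assumes "X \<in> space P"
  shows "is_arg_min (\<lambda>h. A_term K \<kappa> H n G (inf_abs I (gest (second_half n X))) (\<theta>est (second_half n X))
      (gest (second_half n X)) X x0 h + V_pen K \<kappa> n G (inf_abs I (gest (second_half n X))) h) (\<lambda>h. h \<in> H) (hsel X)"
  using sel assms unfolding selected_bandwidth_def space_P by (auto simp: Let_def)

abbreviation "err X \<equiv> f_est K n (\<theta>est (second_half n X)) (gest (second_half n X)) X x0 (hsel X) - f x0"
abbreviation "dev1 h \<equiv> {X \<in> space P. deviation (scaled K h) h (second_half n X) X}"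
abbreviation "dev2 k h \<equiv> {X \<in> space P. deviation (conv (scaled K k) (scaled K h)) h (second_half n X) X}"

definition crude :: real where "crude = (32 / \<delta>\<^sup>2 + 2 * F\<^sup>2) * real n ^ 4"
definition c5 :: real where "c5 = 48 * K1\<^sup>2 + 28 * \<kappa> * K1\<^sup>2 * K2\<^sup>2 * G"
definition c6 :: real where "c6 = 1248 * K1^4 * (G + 1)\<^sup>2"
definition c7 :: real where "c7 = 4992 * K1^4"
text \<open>The factor in front is that of the crude bound. The 4 collects two deviation events,
  each of probability at most 2 n^-12, per bandwidth.\<close>

definition c8 :: real where "c8 = (32 / \<delta>\<^sup>2 + 2 * F\<^sup>2) * (\<bar>C (1/2)\<bar> * exp 216 + 4)"

lemma err_le_crude:
  assumes X: "X \<in> space P" "regular (second_half n X)" "\<forall>i\<in>{1..n}. X i \<in> {0..1}"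
  shows "(err X)\<^sup>2 \<le> crude"
proof -
  have z: "second_half n X \<in> space (half_space n)"
    using measurable_space[OF second_half_measurable X(1)] .
  interpret plugin f \<theta> \<delta> K A a x0 "\<theta>est (second_half n X)" "gest (second_half n X)"
    by (rule plugin_regular[OF z X(2)])
  have "hsel X \<in> H" using hsel_min[OF X(1)] by (simp add: is_arg_min_def)
  then have "0 < hsel X" "a \<le> 1 / hsel X" "1 / hsel X \<le> gm * real n / (ln (real n))^3"
    "1 / hsel X \<le> real n"
    using X(2) H by (auto simp: regular_def)
  from crude_bound[OF n_props(1-3) this] X(3) show ?thesis
    by (auto simp: crude_def)
qed

lemma err_good:
  assumes X: "X \<in> space P" "regular (second_half n X)" "\<forall>i\<in>{1..n}. X i \<in> {0..1}"
    and acc: "accurate (second_half n X)" and k: "k \<in> H"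
    and nd: "\<And>h. h \<in> H \<Longrightarrow> X \<notin> dev1 h" "\<And>h. h \<in> H \<Longrightarrow> X \<notin> dev2 k h"
  shows "ennreal ((err X)\<^sup>2) \<le> ennreal (c5 * ((bias k)\<^sup>2 + ln (real n) / (\<delta>\<^sup>2 * \<gamma>\<^sup>2 * real n * k)))
    + ennreal (c6 / \<delta>^6) * ennreal (\<bar>\<theta>est (second_half n X) - \<theta>\<bar>\<^sup>2)
    + ennreal (c7 / (\<delta>\<^sup>2 * \<gamma>\<^sup>2)) * (esup_norm I (\<lambda>t. gest (second_half n X) t - g t))\<^sup>2"
proof -
  define z where "z = second_half n X"
  have z: "z \<in> space (half_space n)"
    unfolding z_def using measurable_space[OF second_half_measurable X(1)] .
  have reg: "regular z" using X by (simp add: z_def)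
  interpret plugin f \<theta> \<delta> K A a x0 "\<theta>est z" "gest z"
    by (rule plugin_regular[OF z reg])
  have ratio: "\<bar>gest z t - g t\<bar> \<le> \<bar>gest z t\<bar> / 2" if "t \<in> I" for t
    using accurateD[OF acc[folded z_def] gm_pos that] .
  define s where "s = enn2real (esup_norm I (\<lambda>t. gest z t - g t))"
  \<comment> \<open>Accuracy forces |gh - g| <= g <= G, so the extended sup-norm is finite and
    \<open>enn2real\<close> loses nothing.\<close>
  have "esup_norm I (\<lambda>t. gest z t - g t) \<le> ennreal G"
    unfolding esup_norm_def
  proof (rule SUP_least)
    fix t assume t: "t \<in> I"
    have "\<bar>gest z t - g t\<bar> \<le> g t" using ratio[OF t] g_nonneg[of t] by (auto simp: abs_if split: if_splits)
    then show "ennreal \<bar>gest z t - g t\<bar> \<le> ennreal G" using g_le_G[OF t] by (intro ennreal_leI) simp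
  qed
  then have es: "ennreal s = esup_norm I (\<lambda>t. gest z t - g t)"
    unfolding s_def using le_less_trans ennreal_less_top by (intro ennreal_enn2real) blast
  have s: "\<bar>gest z t - g t\<bar> \<le> s" if "t \<in> I" for t
  proof -
    have "ennreal \<bar>gest z t - g t\<bar> \<le> ennreal s"
      unfolding es esup_norm_def using that by (rule SUP_upper)
    then show ?thesis by (simp add: s_def)
  qed
  have H': "0 < h" "a \<le> 1 / h" if "h \<in> H" for h using H reg that by (auto simp: regular_def)
  have k': "0 < k" using H' k by simp
  have "(f_est K n (\<theta>est z) (gest z) X x0 (hsel X) - f x0)\<^sup>2
    \<le> (48 * K1\<^sup>2 + 28 * \<kappa> * K1\<^sup>2 * K2\<^sup>2 * G) * ((bias k)\<^sup>2 + ln (real n) / (\<delta>\<^sup>2 * \<gamma>\<^sup>2 * real n * k))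
      + 1248 * K1^4 * (G + 1)\<^sup>2 / \<delta>^6 * \<bar>\<theta>est z - \<theta>\<bar>\<^sup>2 + 4992 * K1^4 / (\<delta>\<^sup>2 * \<gamma>\<^sup>2) * s\<^sup>2"
  proof (rule good_bound[OF ratio s n_props(1) \<kappa>(1) H(1) k H'])
    show "X i \<in> {0..1}" if "i \<in> {1..n}" for i using X that by blast
    show "is_arg_min (\<lambda>h. A_term K \<kappa> H n G gm (\<theta>est z) (gest z) X x0 h + V_pen K \<kappa> n G gm h) (\<lambda>h. h \<in> H) (hsel X)"
      using hsel_min[OF X(1)] by (simp add: z_def)
    fix h assume "h \<in> H"
    from nd[OF this] show
      "\<bar>1 / real n * (\<Sum>i=1..n. summand (scaled K h) (X i)) - conv (scaled K h) f_plug x0\<bar>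
        \<le> sqrt (V_pen K \<kappa> n G gm h / 6)"
      "\<bar>1 / real n * (\<Sum>i=1..n. summand (conv (scaled K k) (scaled K h)) (X i))
        - conv (conv (scaled K k) (scaled K h)) f_plug x0\<bar> \<le> sqrt (V_pen K \<kappa> n G gm h / 6)"
      using X acc by (auto simp: deviation_def z_def)
  qed
  then have "ennreal ((err X)\<^sup>2) \<le> ennreal (c5 * ((bias k)\<^sup>2 + ln (real n) / (\<delta>\<^sup>2 * \<gamma>\<^sup>2 * real n * k))
      + c6 / \<delta>^6 * \<bar>\<theta>est z - \<theta>\<bar>\<^sup>2 + c7 / (\<delta>\<^sup>2 * \<gamma>\<^sup>2) * s\<^sup>2)"
    unfolding c5_def c6_def c7_def z_def by (rule ennreal_leI)
  also have "\<dots> = ennreal (c5 * ((bias k)\<^sup>2 + ln (real n) / (\<delta>\<^sup>2 * \<gamma>\<^sup>2 * real n * k)))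
      + ennreal (c6 / \<delta>^6) * ennreal (\<bar>\<theta>est z - \<theta>\<bar>\<^sup>2) + ennreal (c7 / (\<delta>\<^sup>2 * \<gamma>\<^sup>2)) * (ennreal s)\<^sup>2"
  proof -
    have split: "ennreal (p + u * v + w * s\<^sup>2) = ennreal p + ennreal u * ennreal v + ennreal w * (ennreal s)\<^sup>2"
      if "0 \<le> p" "0 \<le> u" "0 \<le> v" "0 \<le> w" "0 \<le> s" for p u v w s :: real
      using that by (simp add: ennreal_mult ennreal_power)
    have "0 \<le> c5" "0 \<le> c6 / \<delta>^6" "0 \<le> c7 / (\<delta>\<^sup>2 * \<gamma>\<^sup>2)" "0 \<le> s"
      "0 \<le> (bias k)\<^sup>2 + ln (real n) / (\<delta>\<^sup>2 * \<gamma>\<^sup>2 * real n * k)"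
      using \<kappa> G_pos n_props \<delta> k' by (auto simp: c5_def c6_def c7_def s_def intro!: add_nonneg_nonneg)
    then show ?thesis by (intro split) auto
  qed
  finally show ?thesis by (simp only: es z_def)
qed

text \<open>The oracle k is fixed before the expectation is taken, so the only double kernels to
  control are those involving k.\<close>

lemma risk_bound:
  assumes k: "k \<in> H"
  shows "(\<integral>\<^sup>+X. ennreal ((err X)\<^sup>2) \<partial>P)
    \<le> ennreal (c5 * ((bias k)\<^sup>2 + ln (real n) / (\<delta>\<^sup>2 * \<gamma>\<^sup>2 * real n * k)))
      + ennreal (c6 / \<delta>^6) * (\<integral>\<^sup>+X. ennreal (\<bar>\<theta>est (second_half n X) - \<theta>\<bar>\<^sup>2) \<partial>P)
      + ennreal (c7 / (\<delta>\<^sup>2 * \<gamma>\<^sup>2)) * (\<integral>\<^sup>+X. (esup_norm I (\<lambda>t. gest (second_half n X) t - g t))\<^sup>2 \<partial>P)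
      + ennreal (c8 / (real n)\<^sup>2)"
proof -
  interpret P: prob_space P by (rule prob_space_P)
  define Bad where "Bad = {X \<in> space P. \<not> accurate (second_half n X)}"
  define r5 where "r5 = ennreal (c5 * ((bias k)\<^sup>2 + ln (real n) / (\<delta>\<^sup>2 * \<gamma>\<^sup>2 * real n * k)))"
  define T6 where "T6 X = ennreal (\<bar>\<theta>est (second_half n X) - \<theta>\<bar>\<^sup>2)" for X
  define T7 where "T7 X = (esup_norm I (\<lambda>t. gest (second_half n X) t - g t))\<^sup>2" for X
  \<comment> \<open>The inequality a <= 1/h is deterministic but A5 asserts it only almost surely;
    one sample point from the full-measure event suffices to extract it.\<close>
  obtain X0 where "regular (second_half n X0)"
    using eventually_happens'[OF P.ae_filter_bot AE_regular] by blast
  then have H': "0 < h" "a \<le> 1 / h" if "h \<in> H" for h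
    using H that by (auto simp: regular_def)
  interpret bandwidth f \<theta> \<delta> K A a x0 k by unfold_locales (use H' k in auto)
  have Kmeas: "scaled K h \<in> borel_measurable borel" "conv (scaled K k) (scaled K h) \<in> borel_measurable borel"
    if "h \<in> H" for h using bounded_suppD(1)[OF admissible_kernels(1)[OF H']] bounded_suppD(1)[OF admissible_kernels(3)[OF H']] that by auto
  have dev_meas: "dev1 h \<in> sets P" "dev2 k h \<in> sets P" if "h \<in> H" for h
    by (rule deviation_measurable[OF Kmeas(1)[OF that]], rule deviation_measurable[OF Kmeas(2)[OF that]])
  have "Measurable.pred (half_space n) accurate"
    unfolding accurate_def by measurable
  then have Bad_meas: "Bad \<in> sets P" unfolding Bad_def by measurable
  have T_meas [measurable]: "T6 \<in> borel_measurable P" "T7 \<in> borel_measurable P"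
    unfolding T6_def T7_def by measurable
  have "(\<integral>\<^sup>+X. ennreal ((err X)\<^sup>2) \<partial>P) \<le> (\<integral>\<^sup>+X. r5 + ennreal (c6 / \<delta>^6) * T6 X + ennreal (c7 / (\<delta>\<^sup>2 * \<gamma>\<^sup>2)) * T7 X
      + ennreal crude * (indicator Bad X + (\<Sum>h\<in>H. indicator (dev1 h) X + indicator (dev2 k h) X)) \<partial>P)"
  proof (rule nn_integral_mono_AE)
    show "AE X in P. ennreal ((err X)\<^sup>2) \<le> r5 + ennreal (c6 / \<delta>^6) * T6 X + ennreal (c7 / (\<delta>\<^sup>2 * \<gamma>\<^sup>2)) * T7 X
      + ennreal crude * (indicator Bad X + (\<Sum>h\<in>H. indicator (dev1 h) X + indicator (dev2 k h) X))"
      using AE_regular AE_sample_unit AE_space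
    proof eventually_elim
      case (elim X)
      \<comment> \<open>On the exceptional set the indicators sum to at least 1 and the last term
        alone dominates the crude bound; off it the first three terms dominate.\<close>
      show ?case
      proof (cases "X \<in> Bad \<or> (\<exists>h\<in>H. X \<in> dev1 h \<or> X \<in> dev2 k h)")
        case True
        have "1 \<le> (indicator Bad X + (\<Sum>h\<in>H. indicator (dev1 h) X + indicator (dev2 k h) X) :: ennreal)"
        proof (cases "X \<in> Bad")
          case False
          then obtain h where h: "h \<in> H" "X \<in> dev1 h \<or> X \<in> dev2 k h" using True by auto
          have "1 \<le> (indicator (dev1 h) X + indicator (dev2 k h) X :: ennreal)"
            using h(2) by (auto simp: indicator_def)
          also have "\<dots> \<le> (\<Sum>h\<in>H. indicator (dev1 h) X + indicator (dev2 k h) X)"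
            using H(1) h(1) by (intro member_le_sum) auto
          finally show ?thesis by (rule order_trans) simp
        qed simp
        then have "ennreal crude * 1 \<le> ennreal crude * (indicator Bad X + (\<Sum>h\<in>H. indicator (dev1 h) X + indicator (dev2 k h) X))"
          by (rule mult_left_mono) simp
        moreover have "ennreal ((err X)\<^sup>2) \<le> ennreal crude"
          using err_le_crude[OF elim(3,1,2)] by (rule ennreal_leI)
        ultimately show ?thesis by (intro add_increasing) auto
      next
        case False
        then have "ennreal ((err X)\<^sup>2) \<le> r5 + ennreal (c6 / \<delta>^6) * T6 X + ennreal (c7 / (\<delta>\<^sup>2 * \<gamma>\<^sup>2)) * T7 X"
          unfolding r5_def T6_def T7_def using elim k
          by (intro err_good) (auto simp: Bad_def)
        then show ?thesis by (rule add_increasing2[OF zero_le])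
      qed
    qed
  qed
  also have "\<dots> = r5 + ennreal (c6 / \<delta>^6) * (\<integral>\<^sup>+X. T6 X \<partial>P) + ennreal (c7 / (\<delta>\<^sup>2 * \<gamma>\<^sup>2)) * (\<integral>\<^sup>+X. T7 X \<partial>P)
      + ennreal crude * (emeasure P Bad + (\<Sum>h\<in>H. emeasure P (dev1 h) + emeasure P (dev2 k h)))"
  proof -
    define D where "D h X = (indicator (dev1 h) X + indicator (dev2 k h) X :: ennreal)" for h X
    have D: "D h \<in> borel_measurable P" "(\<integral>\<^sup>+X. D h X \<partial>P) = emeasure P (dev1 h) + emeasure P (dev2 k h)"
      if "h \<in> H" for h
      unfolding D_def using dev_meas[OF that]
      by (auto simp del: mem_Collect_eq simp: nn_integral_add)
    define R where "R X = indicator Bad X + (\<Sum>h\<in>H. D h X)" for X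
    have R: "R \<in> borel_measurable P"
      unfolding R_def using Bad_meas D(1) by (intro borel_measurable_add borel_measurable_sum) auto
    have IR: "(\<integral>\<^sup>+X. R X \<partial>P) = emeasure P Bad + (\<Sum>h\<in>H. emeasure P (dev1 h) + emeasure P (dev2 k h))"
      unfolding R_def using Bad_meas D
      by (subst nn_integral_add) (auto simp: nn_integral_sum intro!: borel_measurable_sum)
    have "(\<integral>\<^sup>+X. r5 + ennreal (c6 / \<delta>^6) * T6 X + ennreal (c7 / (\<delta>\<^sup>2 * \<gamma>\<^sup>2)) * T7 X + ennreal crude * R X \<partial>P)
      = r5 + ennreal (c6 / \<delta>^6) * (\<integral>\<^sup>+X. T6 X \<partial>P) + ennreal (c7 / (\<delta>\<^sup>2 * \<gamma>\<^sup>2)) * (\<integral>\<^sup>+X. T7 X \<partial>P)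
        + ennreal crude * (\<integral>\<^sup>+X. R X \<partial>P)"
      using R by (simp add: nn_integral_add nn_integral_cmult P.emeasure_space_1)
    then show ?thesis unfolding IR unfolding R_def D_def .
  qed
  also have "\<dots> \<le> r5 + ennreal (c6 / \<delta>^6) * (\<integral>\<^sup>+X. T6 X \<partial>P) + ennreal (c7 / (\<delta>\<^sup>2 * \<gamma>\<^sup>2)) * (\<integral>\<^sup>+X. T7 X \<partial>P)
      + ennreal (c8 / (real n)\<^sup>2)"
  proof (rule add_left_mono)
    define q where "q = exp (- (ln (real n) powr (3/2)))"
    have "emeasure P Bad + (\<Sum>h\<in>H. emeasure P (dev1 h) + emeasure P (dev2 k h))
        \<le> ennreal (\<bar>C (1/2)\<bar> * q) + (\<Sum>h\<in>H. ennreal (2 / real n ^ 12) + ennreal (2 / real n ^ 12))"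
      unfolding Bad_def q_def
      by (intro add_mono sum_mono inaccurate_prob_le
          deviation_prob_le[OF _ admissible_kernels(1,2)[OF H']]
          deviation_prob_le[OF _ admissible_kernels(3,4)[OF H']])
    also have "\<dots> = ennreal (\<bar>C (1/2)\<bar> * q + real (card H) * (4 / real n ^ 12))"
    proof -
      have "ennreal x + (\<Sum>h\<in>H. ennreal y + ennreal y) = ennreal (x + real (card H) * (2 * y))"
        if "0 \<le> x" "0 \<le> y" for x y
      proof -
        have "(\<Sum>h\<in>H. ennreal y + ennreal y) = (\<Sum>h\<in>H. ennreal (2 * y))"
          using that by (simp flip: ennreal_plus)
        also have "\<dots> = ennreal (\<Sum>h\<in>H. 2 * y)" using that by (intro sum_ennreal) auto
        finally show ?thesis using that by (simp flip: ennreal_plus)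
      qed
      from this[of "\<bar>C (1/2)\<bar> * q" "2 / real n ^ 12"] show ?thesis by (simp add: q_def)
    qed
    finally have "ennreal crude * (emeasure P Bad + (\<Sum>h\<in>H. emeasure P (dev1 h) + emeasure P (dev2 k h)))
        \<le> ennreal crude * ennreal (\<bar>C (1/2)\<bar> * q + real (card H) * (4 / real n ^ 12))"
      by (rule mult_left_mono) simp
    also have "\<dots> = ennreal (crude * (\<bar>C (1/2)\<bar> * q + real (card H) * (4 / real n ^ 12)))"
      by (rule ennreal_mult[symmetric]) (auto simp: crude_def q_def)
    also have "\<dots> \<le> ennreal (c8 / (real n)\<^sup>2)"
    proof (rule ennreal_leI)
      define N where "N = real n"
      have N: "1 < N" using n_props by (simp add: N_def)
      have 1: "N^4 * q \<le> exp 216 / N\<^sup>2"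
      proof -
        have "N^4 * q * N\<^sup>2 = N^6 * q" by (simp add: eval_nat_numeral mult_ac)
        also have "\<dots> \<le> exp 216" using exp_ln_powr_decay[OF n_props(1)] by (simp add: N_def q_def)
        finally show ?thesis using N by (simp add: pos_le_divide_eq)
      qed
      \<comment> \<open>The union over at most n bandwidths and the crude factor n^4 reduce n^-12 to
        n^-7, well below the target n^-2.\<close>
      have 2: "N^4 * (real (card H) * (4 / N^12)) \<le> 4 / N\<^sup>2"
      proof -
        have "N^4 * (real (card H) * (4 / N^12)) \<le> N^4 * (N * (4 / N^12))"
          using H(3) N by (intro mult_left_mono mult_right_mono) (auto simp: N_def)
        also have "\<dots> = 4 / N^7"
        proof -
          have "x * (N * (4 / (x * N * y))) = 4 / y" if "x \<noteq> 0" for x y :: real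
            using N that by simp
          from this[of "N^4" "N^7"] have "N^4 * (N * (4 / (N^4 * N * N^7))) = 4 / N^7" using N by fastforce
          moreover have "N^4 * N * N^7 = N^12" by (simp add: eval_nat_numeral)
          ultimately show ?thesis by metis
        qed
        also have "\<dots> \<le> 4 / N\<^sup>2" using N by (intro divide_left_mono power_increasing) auto
        finally show ?thesis .
      qed
      have "N^4 * (\<bar>C (1/2)\<bar> * q + real (card H) * (4 / N^12))
          = \<bar>C (1/2)\<bar> * (N^4 * q) + N^4 * (real (card H) * (4 / N^12))"
        by (simp only: distrib_left mult_ac)
      also have "\<dots> \<le> \<bar>C (1/2)\<bar> * (exp 216 / N\<^sup>2) + 4 / N\<^sup>2"
        using 1 2 by (intro add_mono mult_left_mono) auto
      finally have "(32 / \<delta>\<^sup>2 + 2 * F\<^sup>2) * (N^4 * (\<bar>C (1/2)\<bar> * q + real (card H) * (4 / N^12)))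
          \<le> (32 / \<delta>\<^sup>2 + 2 * F\<^sup>2) * (\<bar>C (1/2)\<bar> * (exp 216 / N\<^sup>2) + 4 / N\<^sup>2)"
        by (intro mult_left_mono) auto
      also have "\<dots> = c8 / N\<^sup>2" unfolding c8_def times_divide_eq_right
        by (simp only: add_divide_distrib[symmetric] times_divide_eq_right)
      finally show "crude * (\<bar>C (1/2)\<bar> * q + real (card H) * (4 / real n ^ 12)) \<le> c8 / (real n)\<^sup>2"
        by (simp add: crude_def N_def mult.assoc)
    qed
    finally show "ennreal crude * (emeasure P Bad + (\<Sum>h\<in>H. emeasure P (dev1 h) + emeasure P (dev2 k h)))
        \<le> ennreal (c8 / (real n)\<^sup>2)" .
  qed
  finally show ?thesis by (simp only: r5_def T6_def T7_def)
qed

end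

context adaptive_estimation
begin

text \<open>The minimum over a finite family is attained, and its minimiser serves as oracle; the
  true \<theta> is one of the parameters in the supremum.\<close>

lemma risk_bound_Min:
  assumes c: "c5 \<le> C5" "c6 \<le> C6" "c7 \<le> C7" "c8 \<le> C8"
  shows "(\<integral>\<^sup>+X. ennreal ((err X)\<^sup>2) \<partial>P)
    \<le> ennreal (C5 * Min ((\<lambda>h. (bias h)\<^sup>2 + ln (real n) / (\<delta>\<^sup>2 * \<gamma>\<^sup>2 * real n * h)) ` H))
      + ennreal (C6 / \<delta>^6) * (SUP \<theta>'\<in>{\<delta>..1 - \<delta>}.
          \<integral>\<^sup>+X. ennreal (\<bar>\<theta>est (second_half n X) - \<theta>'\<bar>\<^sup>2) \<partial>sample_law \<theta>' f n)
      + ennreal (C7 / (\<delta>\<^sup>2 * \<gamma>\<^sup>2)) * (\<integral>\<^sup>+X. (esup_norm I (\<lambda>t. gest (second_half n X) t - g t))\<^sup>2 \<partial>P)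
      + ennreal (C8 / (real n)\<^sup>2)"
proof -
  let ?r = "\<lambda>h. (bias h)\<^sup>2 + ln (real n) / (\<delta>\<^sup>2 * \<gamma>\<^sup>2 * real n * h)"
  have "Min (?r ` H) \<in> ?r ` H" using H by (intro Min_in) auto
  then obtain k where k: "k \<in> H" "Min (?r ` H) = ?r k" by auto
  have "0 \<le> ?r k" using k H n_props by auto
  then have c5: "c5 * ?r k \<le> C5 * Min (?r ` H)" unfolding k(2) using c by (intro mult_right_mono)
  have c678: "c6 / \<delta>^6 \<le> C6 / \<delta>^6" "c7 / (\<delta>\<^sup>2 * \<gamma>\<^sup>2) \<le> C7 / (\<delta>\<^sup>2 * \<gamma>\<^sup>2)" "c8 / (real n)\<^sup>2 \<le> C8 / (real n)\<^sup>2"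
    using c \<delta> by (auto intro!: divide_right_mono)
  have sup: "(\<integral>\<^sup>+X. ennreal (\<bar>\<theta>est (second_half n X) - \<theta>\<bar>\<^sup>2) \<partial>P)
      \<le> (SUP \<theta>'\<in>{\<delta>..1 - \<delta>}. \<integral>\<^sup>+X. ennreal (\<bar>\<theta>est (second_half n X) - \<theta>'\<bar>\<^sup>2) \<partial>sample_law \<theta>' f n)"
    using \<theta> by (intro SUP_upper) auto
  show ?thesis
    by (intro order_trans[OF risk_bound[OF k(1)]] add_mono mult_mono order_refl sup
        c5[THEN ennreal_leI] c678[THEN ennreal_leI]) auto
qed

end

section \<open>The risk bound\<close>

text \<open>The order of the quantifiers encodes what the constants may depend on; \<open>C8\<close>
  is chosen after \<open>Cg\<close>, the constants of A3, which depend on g and \<nu>. "Large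
  enough" for the tuning parameter means above \<open>\<kappa>0\<close>, a function of \<delta> and
  G.\<close>

theorem theorem1:
  shows "\<exists>(N :: (real \<Rightarrow> real) \<Rightarrow> real) (\<kappa>0 :: real \<Rightarrow> real \<Rightarrow> real)
      (C5 :: real \<Rightarrow> real \<Rightarrow> real \<Rightarrow> real \<Rightarrow> real) (C6 :: real \<Rightarrow> real \<Rightarrow> real) (C7 :: real \<Rightarrow> real \<Rightarrow> real).
    (\<forall>\<kappa> G K1 K2. 0 < C5 \<kappa> G K1 K2) \<and> (\<forall>G K1. 0 < C6 G K1) \<and> (\<forall>G K1. 0 < C7 G K1) \<and>
    (\<forall>Cg :: (real \<Rightarrow> real) \<Rightarrow> real \<Rightarrow> real.
      \<exists>C8 :: real \<Rightarrow> real \<Rightarrow> real \<Rightarrow> (real \<Rightarrow> real) \<Rightarrow> real \<Rightarrow> real \<Rightarrow> real.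
      (\<forall>\<delta> \<gamma> F g K2 Kinf. 0 < C8 \<delta> \<gamma> F g K2 Kinf) \<and>
      (\<forall>(f :: real \<Rightarrow> real) (\<theta> :: real) (\<delta> :: real) (K :: real \<Rightarrow> real) (A :: real)
        (\<alpha> :: nat \<Rightarrow> real) (x0 :: real) (n :: nat) (\<kappa> :: real) (H :: real set)
        (\<theta>est :: (nat \<Rightarrow> real) \<Rightarrow> real) (gest :: (nat \<Rightarrow> real) \<Rightarrow> real \<Rightarrow> real)
        (hsel :: (nat \<Rightarrow> real) \<Rightarrow> real).
        let g = mixture \<theta> f;
            P = sample_law \<theta> f n;
            J = nbhd A (\<alpha> n) x0;
            I = nbhd01 A (\<alpha> n) x0;
            G = sup_norm I g;
            \<gamma> = inf_abs I g
        in
        unit_density f \<longrightarrow> 0 < \<delta> \<longrightarrow> \<delta> < 1 \<longrightarrow> 0 < \<theta> \<longrightarrow> \<theta> < 1 \<longrightarrow> \<theta> \<in> {\<delta>..1 - \<delta>} \<longrightarrow>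
        smoothing_kernel K A \<longrightarrow>
        (\<forall>m. 1 < \<alpha> m) \<longrightarrow> filterlim \<alpha> at_top sequentially \<longrightarrow>
        x0 \<in> {0..1} \<longrightarrow>
        preliminary_estimators n I g \<theta>est gest \<longrightarrow>
        finite H \<longrightarrow> H \<noteq> {} \<longrightarrow> card H \<le> n \<longrightarrow> (\<forall>h\<in>H. 0 < h) \<longrightarrow>
        0 < \<kappa> \<longrightarrow> \<kappa>0 \<delta> G \<le> \<kappa> \<longrightarrow>
        selected_bandwidth K \<kappa> H n G I \<theta>est gest x0 hsel \<longrightarrow>
        assm_A1 f J \<longrightarrow>
        assm_A2 P n I gest \<longrightarrow>
        assm_A3 P n I g gest (Cg g) \<longrightarrow>
        assm_A4 P n \<delta> \<theta>est \<longrightarrow>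
        (\<forall>h\<in>H. assm_A5 P n I gest (\<alpha> n) h) \<longrightarrow>
        N K < real n \<longrightarrow>
        (\<integral>\<^sup>+X. ennreal ((f_est K n (\<theta>est (second_half n X)) (gest (second_half n X)) X x0 (hsel X)
                        - f x0)\<^sup>2) \<partial>P)
        \<le> ennreal (C5 \<kappa> G (Lp_norm 1 K) (Lp_norm 2 K) *
              Min ((\<lambda>h. (sup_norm J (\<lambda>t. conv (scaled K h) f t - f t))\<^sup>2
                        + ln (real n) / (\<delta>\<^sup>2 * \<gamma>\<^sup>2 * real n * h)) ` H))
          + ennreal (C6 G (Lp_norm 1 K) / \<delta>^6) *
              (SUP \<theta>'\<in>{\<delta>..1 - \<delta>}.
                 \<integral>\<^sup>+X. ennreal (\<bar>\<theta>est (second_half n X) - \<theta>'\<bar>\<^sup>2) \<partial>sample_law \<theta>' f n)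
          + ennreal (C7 G (Lp_norm 1 K) / (\<delta>\<^sup>2 * \<gamma>\<^sup>2)) *
              (\<integral>\<^sup>+X. (esup_norm I (\<lambda>t. gest (second_half n X) t - g t))\<^sup>2 \<partial>P)
          + ennreal (C8 \<delta> \<gamma> (sup_norm J f) g (Lp_norm 2 K) (sup_norm UNIV K) / (real n)\<^sup>2)))"
proof -
  define N where "N K = 3 + Lp_norm 1 K + sup_norm UNIV K + exp (sup_norm UNIV K / Lp_norm 2 K)" for K
  define \<kappa>0 where "\<kappa>0 \<delta> G = 48^3 * (1 + 2 * G)\<^sup>2 / \<delta>\<^sup>2" for \<delta> G :: real
  \<comment> \<open>Positivity is claimed for arbitrary real arguments, hence the added 1 in each
    constant and the absolute values in \<open>C5\<close>. The value of \<open>Cg\<close> at 1/2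
    enters \<open>C8\<close> through the accuracy event.\<close>
  define C5 where "C5 \<kappa> G K1 K2 = 1 + 48 * K1\<^sup>2 + 28 * \<bar>\<kappa>\<bar> * K1\<^sup>2 * K2\<^sup>2 * \<bar>G\<bar>" for \<kappa> G K1 K2 :: real
  define C6 where "C6 G K1 = 1 + 1248 * K1^4 * (G + 1)\<^sup>2" for G K1 :: real
  define C7 where "C7 G K1 = 1 + 4992 * K1^4" for G K1 :: real
  define C8 where "C8 Cg \<delta> \<gamma> F g K2 Kinf = 1 + (32 / \<delta>\<^sup>2 + 2 * F\<^sup>2) * (\<bar>Cg g (1/2)\<bar> * exp 216 + 4)"
    for Cg :: "(real \<Rightarrow> real) \<Rightarrow> real \<Rightarrow> real" and \<delta> \<gamma> F :: real and g :: "real \<Rightarrow> real" and K2 Kinf :: real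
  show ?thesis
  proof (rule exI[of _ N], rule exI[of _ \<kappa>0], rule exI[of _ C5], rule exI[of _ C6], rule exI[of _ C7],
      intro conjI allI)
    show "0 < C5 \<kappa> G K1 K2" for \<kappa> G K1 K2
      unfolding C5_def by (intro add_pos_nonneg) auto
    show "0 < C6 G K1" "0 < C7 G K1" for G K1
      unfolding C6_def C7_def by (intro add_pos_nonneg; simp)+
    fix Cg :: "(real \<Rightarrow> real) \<Rightarrow> real \<Rightarrow> real"
    show "\<exists>C8 :: real \<Rightarrow> real \<Rightarrow> real \<Rightarrow> (real \<Rightarrow> real) \<Rightarrow> real \<Rightarrow> real \<Rightarrow> real.
      (\<forall>\<delta> \<gamma> F g K2 Kinf. 0 < C8 \<delta> \<gamma> F g K2 Kinf) \<and>
      (\<forall>(f :: real \<Rightarrow> real) (\<theta> :: real) (\<delta> :: real) (K :: real \<Rightarrow> real) (A :: real)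
        (\<alpha> :: nat \<Rightarrow> real) (x0 :: real) (n :: nat) (\<kappa> :: real) (H :: real set)
        (\<theta>est :: (nat \<Rightarrow> real) \<Rightarrow> real) (gest :: (nat \<Rightarrow> real) \<Rightarrow> real \<Rightarrow> real)
        (hsel :: (nat \<Rightarrow> real) \<Rightarrow> real).
        let g = mixture \<theta> f;
            P = sample_law \<theta> f n;
            J = nbhd A (\<alpha> n) x0;
            I = nbhd01 A (\<alpha> n) x0;
            G = sup_norm I g;
            \<gamma> = inf_abs I g
        in
        unit_density f \<longrightarrow> 0 < \<delta> \<longrightarrow> \<delta> < 1 \<longrightarrow> 0 < \<theta> \<longrightarrow> \<theta> < 1 \<longrightarrow> \<theta> \<in> {\<delta>..1 - \<delta>} \<longrightarrow>
        smoothing_kernel K A \<longrightarrow>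
        (\<forall>m. 1 < \<alpha> m) \<longrightarrow> filterlim \<alpha> at_top sequentially \<longrightarrow>
        x0 \<in> {0..1} \<longrightarrow>
        preliminary_estimators n I g \<theta>est gest \<longrightarrow>
        finite H \<longrightarrow> H \<noteq> {} \<longrightarrow> card H \<le> n \<longrightarrow> (\<forall>h\<in>H. 0 < h) \<longrightarrow>
        0 < \<kappa> \<longrightarrow> \<kappa>0 \<delta> G \<le> \<kappa> \<longrightarrow>
        selected_bandwidth K \<kappa> H n G I \<theta>est gest x0 hsel \<longrightarrow>
        assm_A1 f J \<longrightarrow>
        assm_A2 P n I gest \<longrightarrow>
        assm_A3 P n I g gest (Cg g) \<longrightarrow>
        assm_A4 P n \<delta> \<theta>est \<longrightarrow>
        (\<forall>h\<in>H. assm_A5 P n I gest (\<alpha> n) h) \<longrightarrow>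
        N K < real n \<longrightarrow>
        (\<integral>\<^sup>+X. ennreal ((f_est K n (\<theta>est (second_half n X)) (gest (second_half n X)) X x0 (hsel X)
                        - f x0)\<^sup>2) \<partial>P)
        \<le> ennreal (C5 \<kappa> G (Lp_norm 1 K) (Lp_norm 2 K) *
              Min ((\<lambda>h. (sup_norm J (\<lambda>t. conv (scaled K h) f t - f t))\<^sup>2
                        + ln (real n) / (\<delta>\<^sup>2 * \<gamma>\<^sup>2 * real n * h)) ` H))
          + ennreal (C6 G (Lp_norm 1 K) / \<delta>^6) *
              (SUP \<theta>'\<in>{\<delta>..1 - \<delta>}.
                 \<integral>\<^sup>+X. ennreal (\<bar>\<theta>est (second_half n X) - \<theta>'\<bar>\<^sup>2) \<partial>sample_law \<theta>' f n)
          + ennreal (C7 G (Lp_norm 1 K) / (\<delta>\<^sup>2 * \<gamma>\<^sup>2)) *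
              (\<integral>\<^sup>+X. (esup_norm I (\<lambda>t. gest (second_half n X) t - g t))\<^sup>2 \<partial>P)
          + ennreal (C8 \<delta> \<gamma> (sup_norm J f) g (Lp_norm 2 K) (sup_norm UNIV K) / (real n)\<^sup>2))"
    proof (rule exI[of _ "C8 Cg"], intro conjI allI, goal_cases)
      case (1 \<delta> \<gamma> F g K2 Kinf)
      show ?case unfolding C8_def by (intro add_pos_nonneg) auto
    next
      case (2 f \<theta> \<delta> K A \<alpha> x0 n \<kappa> H \<theta>est gest hsel)
      show ?case
        unfolding Let_def
      proof (intro impI, goal_cases)
        case 1
        interpret adaptive_estimation f \<theta> \<delta> K A "\<alpha> n" x0 n \<kappa> H \<theta>est gest hsel "Cg (mixture \<theta> f)"
          using 1 by unfold_locales (auto simp: N_def \<kappa>0_def)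
        show ?case
        proof (rule risk_bound_Min)
          show "c5 \<le> C5 \<kappa> G K1 K2" using \<kappa>(1) G_pos by (simp add: c5_def C5_def)
          show "c6 \<le> C6 G K1" "c7 \<le> C7 G K1" by (simp_all add: c6_def C6_def c7_def C7_def)
          show "c8 \<le> C8 Cg \<delta> \<gamma> F g K2 Kinf" by (simp add: c8_def C8_def)
        qed
      qed
    qed
  qed
qed

end
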